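(* Let $X$ be a formal vector field on $\mathbb{C}^m$ which vanishes at the origin $O$, and let $\mathcal{G}$ be an arbitrary formal tensor field which is invariant with respect to $X$ (i.e. $\mathcal{L}_X\mathcal{G}=0$). Then the formal torus $\mathbb{T}^d$-action on $\mathbb{C}^m$ associated to $X$, where $d$ is the toric degree of $X$, also preserves $\mathcal{G}$.
   Context: A formal vector field (tensor field) on $\mathbb{C}^m$ is one whose coefficients are formal power series at the origin $O$. Let $X=X^{(1)}+X^{(2)}+\cdots$ be the Taylor expansion of $X$ and let $X^{ss}$ be the semisimple part of the linear part $X^{(1)}$ (Jordan decomposition); in suitable linear coordinates $X^{ss}=\sum_{i=1}^m\gamma_iz_i\,\partial/\partial z_i$. The (complex formal) toric degree of $X$ at $O$ is the minimal number $d$ such that one can write $X^{ss}=\sum_{i=1}^d\lambda_iZ_i$ with $\lambda_i\in\mathbb{C}$ and $Z_i=\sum_{j=1}^m a_{ij}z_j\,\partial/\partial z_j$ diagonal vector fields with integer coefficients $a_{ij}\in\mathbb{Z}$; minimality of $d$ means that $\lambda_1,\ldots,\lambda_d$ are incommensurable (linearly independent over $\mathbb{Z}$). By the Poincaré–Birkhoff–Dulac theorem there is a formal coordinate system $(z_1,\ldots,z_m)$ in which $X$ is in normal form, i.e. $[X,X^{ss}]=0$ with $X^{ss}=\sum_{i=1}^m\gamma_iz_i\,\partial/\partial z_i$ diagonal in these coordinates. The formal torus action associated to $X$ is the formal $\mathbb{T}^d$-action generated, in such normalizing coordinates, by the vector fields $\sqrt{-1}\,Z_1,\ldots,\sqrt{-1}\,Z_d$;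 it is intrinsically associated to $X$. It preserves $\mathcal{G}$ if $\mathcal{L}_{Z_i}\mathcal{G}=0$ for all $i=1,\ldots,d$. *)

theory Defs
  imports "HOL-Analysis.Analysis"
begin

section \<open>Formal power series in finitely many variables\<close>

text \<open>
  The variables are indexed by a finite type \<open>'m\<close>, so that \<open>CARD('m)\<close> is the dimension.
  A multi-index is a vector \<open>n :: nat ^ 'm\<close>; the multi-index of the variable \<open>z\<^sub>k\<close> is
  \<open>axis k 1\<close>.
\<close>

typedef 'm mfps = "UNIV :: (nat ^ 'm::finite \<Rightarrow> complex) set"
  morphisms mcoeff Abs_mfps
  by simp

setup_lifting type_definition_mfps

lemma mfps_eq_iff: "f = g \<longleftrightarrow> (\<forall>n. mcoeff f n = mcoeff g n)"
  by transfer auto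

definition splittings :: "nat ^ 'm::finite \<Rightarrow> ((nat ^ 'm) \<times> (nat ^ 'm)) set" where
  "splittings n = {(a, b). a + b = n}"

lemma in_splittings [simp]: "p \<in> splittings n \<longleftrightarrow> fst p + snd p = n"
  by (cases p) (simp add: splittings_def)

lemma finite_splittings [simp]: "finite (splittings (n :: nat ^ 'm::finite))"
proof -
  define F where "F = {f :: 'm \<Rightarrow> nat. \<forall>i. f i \<in> {..n $ i}}"
  have "finite F"
    using finite_PiE[of UNIV "\<lambda>i. {..n $ i}"] unfolding F_def
    by (simp add: PiE_def Pi_def)
  moreover have "splittings n \<subseteq> vec_lambda ` F \<times> vec_lambda ` F"
  proof
    fix p assume "p \<in> splittings n"
    then have eq: "fst p $ i + snd p $ i = n $ i" for i
      by (metis in_splittings vector_add_component)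
    have "vec_nth (fst p) \<in> F" "vec_nth (snd p) \<in> F"
      unfolding F_def using eq le_add1 le_add2 by (auto, metis+)
    then show "p \<in> vec_lambda ` F \<times> vec_lambda ` F"
      by (metis imageI mem_Times_iff vec_nth_inverse)
  qed
  ultimately show ?thesis
    by (meson finite_SigmaI finite_imageI finite_subset)
qed

instantiation mfps :: (finite) comm_ring_1
begin

lift_definition zero_mfps :: "'a mfps" is "\<lambda>_. 0" .
lift_definition one_mfps :: "'a mfps" is "\<lambda>n. if n = 0 then 1 else 0" .
lift_definition plus_mfps :: "'a mfps \<Rightarrow> 'a mfps \<Rightarrow> 'a mfps" is "\<lambda>f g n. f n + g n" .
lift_definition minus_mfps :: "'a mfps \<Rightarrow> 'a mfps \<Rightarrow> 'a mfps" is "\<lambda>f g n. f n - g n" .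
lift_definition uminus_mfps :: "'a mfps \<Rightarrow> 'a mfps" is "\<lambda>f n. - f n" .
lift_definition times_mfps :: "'a mfps \<Rightarrow> 'a mfps \<Rightarrow> 'a mfps" is
  "\<lambda>f g n. \<Sum>(a, b)\<in>splittings n. f a * g b" .

instance
proof
  fix f g h :: "'a mfps"
  show "f * g * h = f * (g * h)"
  proof (transfer, rule ext)
    fix f g h :: "nat ^ 'a \<Rightarrow> complex" and n :: "nat ^ 'a"
    have "(\<Sum>(a, b)\<in>splittings n. (\<Sum>(c, d)\<in>splittings a. f c * g d) * h b)
        = (\<Sum>((a, b), (c, d))\<in>Sigma (splittings n) (\<lambda>p. splittings (fst p)). f c * g d * h b)"
      by (simp add: sum_distrib_right split_def sum.Sigma)
    also have "\<dots> = (\<Sum>((a, b), (c, d))\<in>Sigma (splittings n) (\<lambda>p. splittings (snd p)). f a * (g c * h d))"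
      by (rule sum.reindex_bij_witness[where
            i = "\<lambda>((a, b), (c, d)). ((a + c, d), (a, c))" and
            j = "\<lambda>((a, b), (c, d)). ((c, d + b), (d, b))"])
         (auto simp: add.assoc mult.assoc)
    also have "\<dots> = (\<Sum>(a, b)\<in>splittings n. f a * (\<Sum>(c, d)\<in>splittings b. g c * h d))"
      by (simp add: sum_distrib_left split_def sum.Sigma)
    finally show "(\<Sum>(a, b)\<in>splittings n. (\<Sum>(c, d)\<in>splittings a. f c * g d) * h b)
        = (\<Sum>(a, b)\<in>splittings n. f a * (\<Sum>(c, d)\<in>splittings b. g c * h d))" .
  qed
  show "f * g = g * f"
  proof (transfer, rule ext)
    fix f g :: "nat ^ 'a \<Rightarrow> complex" and n :: "nat ^ 'a"
    show "(\<Sum>(a, b)\<in>splittings n. f a * g b) = (\<Sum>(a, b)\<in>splittings n. g a * f b)"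
      by (rule sum.reindex_bij_witness[where i = prod.swap and j = prod.swap])
         (auto simp: add.commute mult.commute)
  qed
  show "1 * f = f"
  proof (transfer, rule ext)
    fix f :: "nat ^ 'a \<Rightarrow> complex" and n :: "nat ^ 'a"
    have "(\<Sum>(a, b)\<in>splittings n. (if a = 0 then 1 else 0) * f b)
        = (\<Sum>(a, b)\<in>{(0 :: nat ^ 'a, n)}. (if a = 0 then 1 else 0) * f b)"
      by (rule sum.mono_neutral_right) (auto split: if_splits)
    then show "(\<Sum>(a, b)\<in>splittings n. (if a = 0 then 1 else 0) * f b) = f n"
      by simp
  qed
  show "f + g + h = f + (g + h)" "f + g = g + f" "0 + f = f" "- f + f = 0" "f - g = f + - g"
    by (transfer, simp add: fun_eq_iff)+
  show "(f + g) * h = f * h + g * h"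
    by (transfer, simp add: fun_eq_iff split_def ring_distribs sum.distrib)
  show "(0 :: 'a mfps) \<noteq> 1"
    by transfer (auto simp: fun_eq_iff)
qed

end

lift_definition mconst :: "complex \<Rightarrow> 'm::finite mfps" is "\<lambda>c n. if n = 0 then c else 0" .

lift_definition pderiv_mfps :: "'m::finite \<Rightarrow> 'm mfps \<Rightarrow> 'm mfps" is
  "\<lambda>k f n. of_nat (n $ k + 1) * f (n + axis k 1)" .


section \<open>Formal vector fields and formal tensor fields\<close>

text \<open>
  \<open>X :: 'm formal_vf\<close> stands for \<open>\<Sum>k. X $ k \<partial>/\<partial>x\<^sub>k\<close>, where the \<open>x\<^sub>k\<close> are the standard
  coordinates. The same type is used for \<open>m\<close>-tuples of formal functions (coordinate systems).
\<close>

type_synonym 'm formal_vf = "'m mfps ^ 'm"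

definition vf_apply :: "'m::finite formal_vf \<Rightarrow> 'm mfps \<Rightarrow> 'm mfps" where
  "vf_apply X f = (\<Sum>k\<in>UNIV. X $ k * pderiv_mfps k f)"

definition lie_bracket :: "'m::finite formal_vf \<Rightarrow> 'm formal_vf \<Rightarrow> 'm formal_vf" where
  "lie_bracket X Y = (\<chi> i. vf_apply X (Y $ i) - vf_apply Y (X $ i))"

definition vanishes_at_origin :: "'m::finite mfps ^ 'm \<Rightarrow> bool" where
  "vanishes_at_origin F \<longleftrightarrow> (\<forall>i. mcoeff (F $ i) 0 = 0)"

definition linear_part :: "'m::finite mfps ^ 'm \<Rightarrow> complex ^ 'm ^ 'm" where
  "linear_part F = (\<chi> i j. mcoeff (F $ i) (axis j 1))"

text \<open>
  A tensor field \<open>G\<close> of type \<open>(p, q)\<close> has the component \<open>G I J\<close> along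
  \<open>\<partial>/\<partial>x\<^bsub>I!0\<^esub> \<otimes> \<dots> \<otimes> \<partial>/\<partial>x\<^bsub>I!(p-1)\<^esub> \<otimes> dx\<^bsub>J!0\<^esub> \<otimes> \<dots> \<otimes> dx\<^bsub>J!(q-1)\<^esub>\<close>;
  components for index lists of the wrong lengths are zero by convention.
\<close>

type_synonym 'm formal_tensor = "'m list \<Rightarrow> 'm list \<Rightarrow> 'm mfps"

definition tensor_fields :: "nat \<Rightarrow> nat \<Rightarrow> ('m::finite formal_tensor) set" where
  "tensor_fields p q = {G. \<forall>I J. length I \<noteq> p \<or> length J \<noteq> q \<longrightarrow> G I J = 0}"

definition lie_derivative :: "'m::finite formal_vf \<Rightarrow> 'm formal_tensor \<Rightarrow> 'm formal_tensor" where
  "lie_derivative X G = (\<lambda>I J.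
     vf_apply X (G I J)
     - (\<Sum>r<length I. \<Sum>k\<in>UNIV. G (I[r := k]) J * pderiv_mfps k (X $ (I ! r)))
     + (\<Sum>r<length J. \<Sum>k\<in>UNIV. G I (J[r := k]) * pderiv_mfps (J ! r) (X $ k)))"


section \<open>Formal coordinate systems\<close>

definition formal_coords :: "'m::finite mfps ^ 'm \<Rightarrow> bool" where
  "formal_coords z \<longleftrightarrow> vanishes_at_origin z \<and> invertible (linear_part z)"

definition jacobian :: "'m::finite mfps ^ 'm \<Rightarrow> 'm mfps ^ 'm ^ 'm" where
  "jacobian z = (\<chi> i j. pderiv_mfps j (z $ i))"

text \<open>
  The vector field \<open>\<partial>/\<partial>z\<^sub>j\<close> of the coordinate system \<open>z\<close>, written in the standard coordinates:
  it is determined by \<open>vf_apply (coord_vf z j) (z $ i) = (if i = j then 1 else 0)\<close>, so its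
  components form a column of the inverse Jacobian matrix.
\<close>

definition coord_vf :: "'m::finite mfps ^ 'm \<Rightarrow> 'm \<Rightarrow> 'm formal_vf" where
  "coord_vf z j = column j (matrix_inv (jacobian z))"

text \<open>The diagonal vector field \<open>\<Sum>j. c\<^sub>j z\<^sub>j \<partial>/\<partial>z\<^sub>j\<close>.\<close>

definition diag_vf :: "'m::finite mfps ^ 'm \<Rightarrow> complex ^ 'm \<Rightarrow> 'm formal_vf" where
  "diag_vf z c = (\<Sum>j\<in>UNIV. (mconst (c $ j) * z $ j) *s coord_vf z j)"


section \<open>Semisimple part, toric degree and the associated torus action\<close>

definition diag_mat :: "'a::zero ^ 'm \<Rightarrow> 'a ^ 'm ^ 'm" where
  "diag_mat c = (\<chi> i j. if i = j then c $ i else 0)"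

text \<open>The endomorphism \<open>S\<close> becomes \<open>diag_mat c\<close> in the linear coordinates \<open>z = P x\<close>.\<close>

definition diagonalized_by :: "complex ^ 'm ^ 'm \<Rightarrow> complex ^ 'm ^ 'm \<Rightarrow> complex ^ 'm::finite \<Rightarrow> bool" where
  "diagonalized_by P S c \<longleftrightarrow> invertible P \<and> P ** S ** matrix_inv P = diag_mat c"

definition nilpotent_mat :: "complex ^ 'm ^ 'm::finite \<Rightarrow> bool" where
  "nilpotent_mat N \<longleftrightarrow> (\<exists>k. (((**) N) ^^ k) (mat 1) = 0)"

definition is_semisimple_part :: "complex ^ 'm ^ 'm \<Rightarrow> complex ^ 'm ^ 'm::finite \<Rightarrow> bool" where
  "is_semisimple_part S A \<longleftrightarrow>
     (\<exists>P c. diagonalized_by P S c) \<and> nilpotent_mat (A - S) \<and> S ** A = A ** S"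

text \<open>\<open>\<Sum>j. c\<^sub>j z\<^sub>j \<partial>/\<partial>z\<^sub>j = \<Sum>i<d. \<lambda>\<^sub>i Z\<^sub>i\<close> with \<open>Z\<^sub>i = \<Sum>j. a\<^sub>i\<^sub>j z\<^sub>j \<partial>/\<partial>z\<^sub>j\<close>, \<open>a\<^sub>i\<^sub>j\<close> integers.\<close>

definition toric_decomposition ::
    "complex ^ 'm \<Rightarrow> nat \<Rightarrow> (nat \<Rightarrow> complex) \<Rightarrow> (nat \<Rightarrow> int ^ 'm::finite) \<Rightarrow> bool" where
  "toric_decomposition c d lam a \<longleftrightarrow> (\<forall>j. c $ j = (\<Sum>i<d. lam i * of_int (a i $ j)))"

definition toric_degree :: "'m::finite formal_vf \<Rightarrow> nat" where
  "toric_degree X = (LEAST d. \<exists>S P c lam a.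
     is_semisimple_part S (linear_part X) \<and> diagonalized_by P S c \<and> toric_decomposition c d lam a)"

text \<open>
  The coordinates \<open>z\<close> put \<open>X\<close> into Poincare-Birkhoff-Dulac normal form, with
  \<open>X\<^sup>s\<^sup>s = \<Sum>j. c\<^sub>j z\<^sub>j \<partial>/\<partial>z\<^sub>j\<close>. As \<open>X\<close> vanishes at the origin, its linear part is an endomorphism
  of the tangent space there, so passing from \<open>x\<close> to \<open>z\<close> changes it and its semisimple part \<open>S\<close>
  only through conjugation by \<open>linear_part z\<close>.
\<close>

definition normal_form_coords :: "'m::finite formal_vf \<Rightarrow> 'm mfps ^ 'm \<Rightarrow> complex ^ 'm \<Rightarrow> bool" where
  "normal_form_coords X z c \<longleftrightarrow>
     formal_coords z \<and>
     (\<exists>S. is_semisimple_part S (linear_part X) \<and> diagonalized_by (linear_part z) S c) \<and>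
     lie_bracket X (diag_vf z c) = 0"

text \<open>
  The formal torus action associated to \<open>X\<close> is generated by \<open>sqrt(-1) Z 0, \<dots>, sqrt(-1) Z (d - 1)\<close>
  with \<open>d = toric_degree X\<close>; the predicate admits every choice of normalizing coordinates and of
  the decomposition of \<open>X\<^sup>s\<^sup>s\<close>.
\<close>

definition generates_associated_torus :: "'m::finite formal_vf \<Rightarrow> (nat \<Rightarrow> 'm formal_vf) \<Rightarrow> bool" where
  "generates_associated_torus X Z \<longleftrightarrow>
     (\<exists>z c lam a. normal_form_coords X z c \<and> toric_decomposition c (toric_degree X) lam a \<and>
        (\<forall>i<toric_degree X. Z i = diag_vf z (\<chi> j. of_int (a i $ j))))"

definition torus_preserves :: "nat \<Rightarrow> (nat \<Rightarrow> 'm::finite formal_vf) \<Rightarrow> 'm formal_tensor \<Rightarrow> bool" where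
  "torus_preserves d Z G \<longleftrightarrow> (\<forall>i<d. lie_derivative (Z i) G = (\<lambda>I J. 0))"

end

theory Submission
  imports Defs
begin

text \<open>
  Let \<open>z\<close> be normalizing coordinates, \<open>S = \<Sum>\<^sub>j c\<^sub>j z\<^sub>j \<partial>/\<partial>z\<^sub>j\<close> the semisimple part of \<open>X\<close>, and
  \<open>Y = S - X\<close>. The theorem is a form of the fact that the kernel of a linear operator lies in the
  kernel of its semisimple part.

  Modulo tensors vanishing to order \<open>k\<close>, the Lie derivative along \<open>Y\<close> is nilpotent: on each graded
  piece it only depends on the linear part of \<open>Y\<close>, which is a nilpotent matrix
  (\<open>lie_array_topologically_nilpotent\<close>). As \<open>[X, S] = 0\<close>, the Lie derivatives along \<open>X\<close> and \<open>S\<close>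
  commute (\<open>lie_array_commute\<close>). So if the Lie derivative of \<open>G\<close> along \<open>X\<close> vanishes, then
  powers of \<open>L\<^sub>S\<close> and of \<open>L\<^sub>Y = L\<^sub>S - L\<^sub>X\<close> agree on \<open>G\<close>, and some power of \<open>L\<^sub>S\<close> takes \<open>G\<close> into the
  tensors that vanish to order \<open>k\<close>.

  In the frame \<open>\<partial>/\<partial>z\<^sub>j\<close>, \<open>dz\<^sub>j\<close>, the operator \<open>L\<^sub>S\<close> acts on each component of \<open>G\<close> separately, as \<open>S\<close> plus a
  constant, the weight of the component. The monomials in \<open>z\<close> are eigenvectors of this operator and
  span the power series modulo any order. Write \<open>S = \<Sum>\<^sub>i \<lambda>\<^sub>i Z\<^sub>i\<close> with \<open>Z\<^sub>i\<close> having integer eigenvalues. An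
  eigenvalue of \<open>L\<^sub>S\<close> is a combination \<open>\<Sum>\<^sub>i \<lambda>\<^sub>i n\<^sub>i\<close>, where the integer \<open>n\<^sub>i\<close> is the eigenvalue of the Lie
  derivative along \<open>Z\<^sub>i\<close> on the same eigenvector. By minimality of the toric degree the \<open>\<lambda>\<^sub>i\<close> are linearly
  independent over the integers (\<open>minimal_decomposition_independent\<close>), so such an eigenvalue vanishes
  only if all \<open>n\<^sub>i\<close> do. Hence whatever is killed by a power of \<open>L\<^sub>S\<close> modulo order \<open>k\<close> is killed by
  every Lie derivative along \<open>Z\<^sub>i\<close> modulo order \<open>k\<close> (\<open>shifted_deriv_kernel_torus\<close>), and \<open>k\<close> was arbitrary.

  Power series are never substituted into each other: the coordinates \<open>z\<close> enter only through the
  commuting derivations \<open>\<partial>/\<partial>z\<^sub>j\<close> of the original power series ring, and a tensor is compared with its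
  components in the new frame by changing one index at a time (\<open>to_frame_lie_array\<close>).
\<close>

section \<open>Formal power series: derivations and the order filtration\<close>

lemma mcoeff_simps [simp]:
  "mcoeff 0 n = 0" "mcoeff (f + g) n = mcoeff f n + mcoeff g n"
  "mcoeff (f - g) n = mcoeff f n - mcoeff g n" "mcoeff (- f) n = - mcoeff f n"
  by (simp_all add: zero_mfps.rep_eq plus_mfps.rep_eq minus_mfps.rep_eq uminus_mfps.rep_eq)

lemma mcoeff_one: "mcoeff 1 n = (if n = 0 then 1 else 0)"
  by (simp add: one_mfps.rep_eq)

lemma mcoeff_mult: "mcoeff (f * g) n = (\<Sum>s\<in>splittings n. mcoeff f (fst s) * mcoeff g (snd s))"
  by (simp add: times_mfps.rep_eq split_def)

lemma mcoeff_sum: "mcoeff (sum f A) n = (\<Sum>x\<in>A. mcoeff (f x) n)"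
  by (induction A rule: infinite_finite_induct) auto

lemma mcoeff_mult_0: "mcoeff (f * g) 0 = mcoeff f 0 * mcoeff g 0"
proof -
  have "splittings (0 :: nat ^ 'a) = {(0, 0)}"
    by (auto simp: splittings_def vec_eq_iff)
  then show ?thesis by (simp add: mcoeff_mult)
qed

lemma mcoeff_mconst_mult [simp]: "mcoeff (mconst c * f) n = c * mcoeff f n"
proof -
  have "(\<Sum>s\<in>splittings n. (if fst s = 0 then c else 0) * mcoeff f (snd s))
      = (\<Sum>s\<in>{(0 :: nat ^ 'a, n)}. (if fst s = 0 then c else 0) * mcoeff f (snd s))"
    by (rule sum.mono_neutral_right) (auto split: if_splits)
  then show ?thesis by (simp add: mcoeff_mult mconst.rep_eq)
qed

lemma mconst_hom:
  "mconst 0 = 0" "mconst 1 = 1" "mconst (a + b) = mconst a + mconst b"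
  "mconst (a * b) = mconst a * mconst b" "mconst (- a) = - mconst a"
  "mconst (a - b) = mconst a - mconst b"
  by (simp_all add: mfps_eq_iff mconst.rep_eq mcoeff_one)

lemma mconst_sum: "mconst (sum f A) = (\<Sum>x\<in>A. mconst (f x))"
  by (induction A rule: infinite_finite_induct) (auto simp: mconst_hom)

lemma mcoeff_pderiv: "mcoeff (pderiv_mfps k f) n = of_nat (n $ k + 1) * mcoeff f (n + axis k 1)"
  by (simp add: pderiv_mfps.rep_eq)

lemma pderiv_add: "pderiv_mfps k (f + g) = pderiv_mfps k f + pderiv_mfps k g"
  by (simp add: mfps_eq_iff mcoeff_pderiv distrib_left)

lemma pderiv_mult: "pderiv_mfps k (f * g) = pderiv_mfps k f * g + f * pderiv_mfps k g"
proof -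
  \<comment> \<open>The factor \<open>fst s $ k\<close> removes the terms in which the exponent of \<open>u\<close> cannot be lowered by one.\<close>
  have shift: "(\<Sum>s\<in>splittings (n + axis k 1). of_nat (fst s $ k) * (mcoeff u (fst s) * mcoeff v (snd s)))
      = mcoeff (pderiv_mfps k u * v) n" for u v :: "'a mfps" and n
  proof -
    let ?e = "axis k 1 :: nat ^ 'a"
    let ?S = "{s \<in> splittings (n + ?e). fst s $ k \<noteq> 0}"
    have cancel: "a - ?e + ?e = a" if "a $ k \<noteq> 0" for a
      using that by (auto simp: vec_eq_iff axis_def)
    have split: "fst s - ?e + snd s = n" if "s \<in> ?S" for s
    proof -
      have "(fst s - ?e + snd s) + ?e = (fst s - ?e + ?e) + snd s"
        by (simp only: ac_simps)
      also have "\<dots> = n + ?e"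
        using that by (subst cancel) auto
      finally show ?thesis by simp
    qed
    have "(\<Sum>s\<in>splittings (n + ?e). of_nat (fst s $ k) * (mcoeff u (fst s) * mcoeff v (snd s)))
        = (\<Sum>s\<in>?S. of_nat (fst s $ k) * (mcoeff u (fst s) * mcoeff v (snd s)))"
      by (rule sum.mono_neutral_right) auto
    also have "\<dots> = (\<Sum>s\<in>splittings n. of_nat (fst s $ k + 1) * mcoeff u (fst s + ?e) * mcoeff v (snd s))"
      by (rule sum.reindex_bij_witness[where
            i = "\<lambda>s. (fst s + ?e, snd s)" and j = "\<lambda>s. (fst s - ?e, snd s)"])
         (use cancel split in \<open>auto simp: axis_def ac_simps\<close>)
    finally show ?thesis by (simp add: mcoeff_mult mcoeff_pderiv)
  qed
  show ?thesis
    unfolding mfps_eq_iff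
  proof
    fix n
    have swap: "mcoeff (f * pderiv_mfps k g) n = (\<Sum>s\<in>splittings (n + axis k 1).
        of_nat (snd s $ k) * (mcoeff f (fst s) * mcoeff g (snd s)))"
      unfolding mult.commute[of f] shift[symmetric]
      by (rule sum.reindex_bij_witness[where i = prod.swap and j = prod.swap])
         (auto simp: add.commute mult.commute)
    have "fst s $ k + snd s $ k = n $ k + 1" if "s \<in> splittings (n + axis k 1)" for s
      using that by (metis axis_nth in_splittings vector_add_component)
    then have "mcoeff (pderiv_mfps k (f * g)) n = (\<Sum>s\<in>splittings (n + axis k 1).
        of_nat (fst s $ k + snd s $ k) * (mcoeff f (fst s) * mcoeff g (snd s)))"
      by (simp add: mcoeff_pderiv mcoeff_mult sum_distrib_left)
    then show "mcoeff (pderiv_mfps k (f * g)) n = mcoeff (pderiv_mfps k f * g + f * pderiv_mfps k g) n"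
      by (simp add: swap shift[symmetric] distrib_right sum.distrib)
  qed
qed

lemma pderiv_commute: "pderiv_mfps j (pderiv_mfps k f) = pderiv_mfps k (pderiv_mfps j f)"
  by (cases "j = k") (auto simp: mfps_eq_iff mcoeff_pderiv add.commute add.left_commute axis_def)

lemma pderiv_mconst: "pderiv_mfps k (mconst c) = 0"
proof -
  have "n + axis k 1 \<noteq> 0" for n :: "nat ^ 'a"
    by (auto simp: vec_eq_iff axis_def)
  then show ?thesis
    by (auto simp: mfps_eq_iff mcoeff_pderiv mconst.rep_eq)
qed

lemma vf_apply_add: "vf_apply V (f + g) = vf_apply V f + vf_apply V g"
  by (simp add: vf_apply_def pderiv_add distrib_left sum.distrib)

lemma vf_apply_mult: "vf_apply V (f * g) = vf_apply V f * g + f * vf_apply V g"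
  by (simp add: vf_apply_def pderiv_mult distrib_left sum.distrib sum_distrib_left sum_distrib_right
      mult_ac)

lemma vf_apply_mconst [simp]: "vf_apply V (mconst c) = 0"
  by (simp add: vf_apply_def pderiv_mconst)

lemma vf_apply_mconst_mult: "vf_apply V (mconst c * f) = mconst c * vf_apply V f"
  by (simp add: vf_apply_mult)

lemma vf_apply_0 [simp]: "vf_apply V 0 = 0" "vf_apply V 1 = 0"
  using vf_apply_mconst[of V 0] vf_apply_mconst[of V 1] by (simp_all add: mconst_hom)

lemma vf_apply_uminus: "vf_apply V (- f) = - vf_apply V f"
  using vf_apply_mconst_mult[of V "-1" f] by (simp add: mconst_hom)

lemma vf_apply_diff: "vf_apply V (f - g) = vf_apply V f - vf_apply V g"
  using vf_apply_add[of V f "- g"] by (simp add: vf_apply_uminus)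

lemma vf_apply_sum: "vf_apply V (sum f A) = (\<Sum>x\<in>A. vf_apply V (f x))"
  by (induction A rule: infinite_finite_induct) (auto simp: vf_apply_add)

lemma vf_apply_diff_left: "vf_apply (V - W) f = vf_apply V f - vf_apply W f"
  by (simp add: vf_apply_def left_diff_distrib sum_subtractf)

lemma vf_apply_smult_left: "vf_apply (h *s V) f = h * vf_apply V f"
  by (simp add: vf_apply_def sum_distrib_left mult.assoc)

lemma vf_apply_sum_left: "vf_apply (\<Sum>x\<in>A. V x) f = (\<Sum>x\<in>A. vf_apply (V x) f)"
  unfolding vf_apply_def sum_component sum_distrib_right by (rule sum.swap)

lemma pderiv_sum: "pderiv_mfps k (sum f A) = (\<Sum>x\<in>A. pderiv_mfps k (f x))"
proof (induction A rule: infinite_finite_induct)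
qed (use pderiv_mconst[of k 0] in \<open>auto simp: pderiv_add mconst_hom\<close>)

text \<open>The second order terms of the two compositions are symmetric in the partial derivatives
  and cancel.\<close>

lemma vf_apply_lie_bracket:
  "vf_apply (lie_bracket V W) f = vf_apply V (vf_apply W f) - vf_apply W (vf_apply V f)"
proof -
  have second: "vf_apply V (vf_apply W f) = (\<Sum>k\<in>UNIV. vf_apply V (W $ k) * pderiv_mfps k f)
      + (\<Sum>k\<in>UNIV. \<Sum>j\<in>UNIV. V $ j * W $ k * pderiv_mfps j (pderiv_mfps k f))"
    for V W :: "'a formal_vf"
    by (simp add: vf_apply_def[of W] vf_apply_sum vf_apply_mult sum.distrib)
       (simp add: vf_apply_def sum_distrib_left mult_ac)
  have "(\<Sum>k\<in>UNIV. \<Sum>j\<in>UNIV. V $ j * W $ k * pderiv_mfps j (pderiv_mfps k f))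
      = (\<Sum>k\<in>UNIV. \<Sum>j\<in>UNIV. W $ j * V $ k * pderiv_mfps j (pderiv_mfps k f))"
    by (subst sum.swap) (simp add: pderiv_commute mult_ac)
  moreover have "vf_apply (lie_bracket V W) f
      = (\<Sum>k\<in>UNIV. (vf_apply V (W $ k) - vf_apply W (V $ k)) * pderiv_mfps k f)"
    by (subst vf_apply_def) (simp add: lie_bracket_def)
  ultimately show ?thesis
    by (simp add: second left_diff_distrib sum_subtractf)
qed

text \<open>\<open>vanishing k\<close> is the \<open>k\<close>-th power of the maximal ideal of the power series ring; every
  argument below that concerns infinitely many coefficients is reduced to statements modulo these
  ideals.\<close>

definition vanishing :: "nat \<Rightarrow> 'm::finite mfps set" where
  "vanishing k = {f. \<forall>n. (\<Sum>i\<in>UNIV. n $ i) < k \<longrightarrow> mcoeff f n = 0}"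

lemma vanishing_0 [simp]: "f \<in> vanishing 0"
  by (simp add: vanishing_def)

lemma vanishing_1: "f \<in> vanishing (Suc 0) \<longleftrightarrow> mcoeff f 0 = 0"
proof -
  have "(\<Sum>i\<in>UNIV. n $ i) = 0 \<longleftrightarrow> n = 0" for n :: "nat ^ 'a"
    by (auto simp: vec_eq_iff)
  then show ?thesis by (auto simp: vanishing_def)
qed

lemma vanishing_zero [simp]: "0 \<in> vanishing k"
  by (simp add: vanishing_def)

lemma vanishing_add: "f \<in> vanishing k \<Longrightarrow> g \<in> vanishing k \<Longrightarrow> f + g \<in> vanishing k"
  by (simp add: vanishing_def)

lemma vanishing_uminus: "f \<in> vanishing k \<Longrightarrow> - f \<in> vanishing k"
  by (simp add: vanishing_def)

lemma vanishing_diff: "f \<in> vanishing k \<Longrightarrow> g \<in> vanishing k \<Longrightarrow> f - g \<in> vanishing k"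
  by (simp add: vanishing_def)

lemma vanishing_sum: "(\<And>x. x \<in> A \<Longrightarrow> f x \<in> vanishing k) \<Longrightarrow> sum f A \<in> vanishing k"
  by (induction A rule: infinite_finite_induct) (auto simp: vanishing_add)

lemma vanishing_mono: "f \<in> vanishing k \<Longrightarrow> j \<le> k \<Longrightarrow> f \<in> vanishing j"
  by (auto simp: vanishing_def)

lemma vanishing_mult:
  assumes "f \<in> vanishing j" "g \<in> vanishing k"
  shows "f * g \<in> vanishing (j + k)"
  unfolding vanishing_def
proof safe
  fix n :: "nat ^ 'a" assume n: "(\<Sum>i\<in>UNIV. n $ i) < j + k"
  have "mcoeff f (fst s) * mcoeff g (snd s) = 0" if "s \<in> splittings n" for s
  proof -
    have "(\<Sum>i\<in>UNIV. fst s $ i) + (\<Sum>i\<in>UNIV. snd s $ i) = (\<Sum>i\<in>UNIV. n $ i)"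
      using that by (auto simp flip: sum.distrib)
    then have "(\<Sum>i\<in>UNIV. fst s $ i) < j \<or> (\<Sum>i\<in>UNIV. snd s $ i) < k"
      using n by linarith
    then show ?thesis using assms by (auto simp: vanishing_def)
  qed
  then show "mcoeff (f * g) n = 0" unfolding mcoeff_mult by (rule sum.neutral[OF ballI])
qed

lemma vanishing_mult_left: "g \<in> vanishing k \<Longrightarrow> f * g \<in> vanishing k"
  using vanishing_mult[of f 0 g k] by simp

lemma vanishing_all_imp_zero: "(\<And>k. f \<in> vanishing k) \<Longrightarrow> f = 0"
  unfolding vanishing_def mfps_eq_iff by (simp, blast)

lemma vanishing_pderiv:
  assumes "f \<in> vanishing (Suc k)"
  shows "pderiv_mfps i f \<in> vanishing k"
  using assms by (auto simp: vanishing_def mcoeff_pderiv sum.distrib axis_def)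

lemma vanishing_Suc_pderiv:
  assumes "mcoeff f 0 = 0" "\<And>i. pderiv_mfps i f \<in> vanishing k"
  shows "f \<in> vanishing (Suc k)"
  unfolding vanishing_def
proof safe
  fix n :: "nat ^ 'a" assume n: "(\<Sum>i\<in>UNIV. n $ i) < Suc k"
  show "mcoeff f n = 0"
  proof (cases "n = 0")
    case False
    then obtain i where i: "n $ i \<noteq> 0" by (auto simp: vec_eq_iff)
    define l where "l = n - axis i 1"
    have n_eq: "n = l + axis i 1" using i by (auto simp: vec_eq_iff axis_def l_def)
    have "(\<Sum>i\<in>UNIV. l $ i) < k"
      using n unfolding n_eq by (simp add: sum.distrib axis_def)
    then have "mcoeff (pderiv_mfps i f) l = 0"
      using assms(2)[of i] by (auto simp: vanishing_def)
    then have "of_nat (Suc (l $ i)) * mcoeff f n = (0 :: complex)" by (simp add: mcoeff_pderiv n_eq)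
    then show ?thesis using of_nat_neq_0 mult_eq_0_iff by blast
  qed (use assms in simp)
qed

lemma vanishing_vf_apply_Suc: "f \<in> vanishing (Suc k) \<Longrightarrow> vf_apply V f \<in> vanishing k"
  by (simp add: vf_apply_def vanishing_sum vanishing_mult_left vanishing_pderiv)

lemma vanishing_vf_apply:
  assumes "vanishes_at_origin V" "f \<in> vanishing k"
  shows "vf_apply V f \<in> vanishing k"
proof (cases k)
  case (Suc l)
  have "V $ i * pderiv_mfps i f \<in> vanishing (1 + l)" for i
    using assms Suc
    by (intro vanishing_mult) (auto simp: vanishing_1 vanishes_at_origin_def vanishing_pderiv)
  then show ?thesis by (simp add: vf_apply_def vanishing_sum Suc)
qed simp

section \<open>The moving frame of a formal coordinate system\<close>

definition constant_part :: "'m::finite mfps ^ 'm ^ 'm \<Rightarrow> complex ^ 'm ^ 'm" where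
  "constant_part A = (\<chi> i j. mcoeff (A $ i $ j) 0)"

lemma mcoeff_mconst_0 [simp]: "mcoeff (mconst c) 0 = c"
  by (simp add: mconst.rep_eq)

lemma constant_part_mult: "constant_part (A ** B) = constant_part A ** constant_part B"
  by (simp add: constant_part_def matrix_matrix_mult_def vec_eq_iff mcoeff_sum mcoeff_mult_0)

lemma constant_part_mat_1: "constant_part (mat 1) = mat 1"
  by (simp add: constant_part_def mat_def vec_eq_iff mcoeff_one)

lemma matrix_sub_ldistrib: "A ** (U - V) = A ** U - A ** V"
  for A U V :: "'a::ring_1 ^ 'n::finite ^ 'n"
  by (simp add: matrix_matrix_mult_def vec_eq_iff right_diff_distrib sum_subtractf)

lemma matrix_sub_rdistrib: "(U - V) ** A = U ** A - V ** A"
  for A U V :: "'a::ring_1 ^ 'n::finite ^ 'n"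
  by (simp add: matrix_matrix_mult_def vec_eq_iff left_diff_distrib sum_subtractf)

text \<open>The inverse of \<open>1 - N\<close> is the geometric series of \<open>N\<close>. It converges because the entries of \<open>N\<close>
  have no constant term, so that the partial sums \<open>S K\<close> and \<open>S L\<close> agree below order \<open>K\<close> for \<open>K \<le> L\<close>.\<close>

lemma geometric_series_matrix:
  fixes N :: "'m::finite mfps ^ 'm ^ 'm"
  assumes N: "constant_part N = 0"
  shows "\<exists>R. (mat 1 - N) ** R = mat 1 \<and> R ** (mat 1 - N) = mat 1"
proof -
  have N1: "N $ i $ j \<in> vanishing 1" for i j
    using N by (simp add: constant_part_def vec_eq_iff vanishing_1)
  \<comment> \<open>\<open>S K\<close> is the sum of the powers of \<open>N\<close> with exponents below \<open>K\<close>.\<close>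
  define S where "S = rec_nat 0 (\<lambda>_ T. mat 1 + N ** T)"
  have S_simps: "S 0 = 0" "S (Suc K) = mat 1 + N ** S K" for K
    by (simp_all add: S_def)
  have step: "(S (Suc K) - S K) $ i $ j \<in> vanishing K" for K i j
  proof (induction K arbitrary: i j)
    case (Suc K)
    have "S (Suc (Suc K)) - S (Suc K) = N ** (S (Suc K) - S K)"
      unfolding S_simps(2)[of "Suc K"] S_simps(2)[of K]
      by (simp add: matrix_sub_ldistrib matrix_add_ldistrib)
    also have "\<dots> $ i $ j \<in> vanishing (1 + K)"
      unfolding matrix_matrix_mult_def vec_lambda_beta
      by (intro vanishing_sum vanishing_mult N1 Suc.IH)
    finally show ?case by simp
  qed simp
  have step_le: "(S L - S K) $ i $ j \<in> vanishing K" if "K \<le> L" for K L i j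
    using that
  proof (induction L rule: dec_induct)
    case (step L)
    then show ?case
      using vanishing_add[OF vanishing_mono[OF \<open>(S (Suc L) - S L) $ i $ j \<in> vanishing L\<close>] step.IH] by simp
  qed simp
  \<comment> \<open>A coefficient of total degree \<open>n\<close> is stationary from the partial sum \<open>S (n + 1)\<close> onwards.\<close>
  define R where "R = (\<chi> i j. Abs_mfps (\<lambda>n. mcoeff (S (Suc (\<Sum>i\<in>UNIV. n $ i)) $ i $ j) n))"
  have lim: "(R - S K) $ i $ j \<in> vanishing K" for K i j
    unfolding vanishing_def
  proof safe
    fix n :: "nat ^ 'm" assume "(\<Sum>i\<in>UNIV. n $ i) < K"
    then have "(S K - S (Suc (\<Sum>i\<in>UNIV. n $ i))) $ i $ j \<in> vanishing (Suc (\<Sum>i\<in>UNIV. n $ i))"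
      by (intro step_le) simp
    then show "mcoeff ((R - S K) $ i $ j) n = 0"
      by (simp add: vanishing_def R_def Abs_mfps_inverse)
  qed
  have commute: "S K ** N = N ** S K" for K
  proof (induction K)
    case (Suc K)
    have "(mat 1 + N ** S K) ** N = N + N ** S K ** N"
      by (simp add: matrix_matrix_mult_def vec_eq_iff mat_def distrib_right sum.distrib
          if_distrib[of "\<lambda>x. x * _"] cong: if_cong)
    then show ?case
      by (simp add: Suc S_simps matrix_add_ldistrib flip: matrix_mul_assoc)
  qed (simp add: S_simps)
  have "((mat 1 - N) ** R - mat 1) $ i $ j \<in> vanishing K" for i j K
  proof -
    have eq: "(mat 1 - N) ** R - mat 1 = (R - S K) - N ** (R - S K) - (S (Suc K) - S K)"
      by (simp add: S_simps matrix_sub_ldistrib matrix_sub_rdistrib)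
    have rest: "(N ** (R - S K)) $ i $ j \<in> vanishing K"
      unfolding matrix_matrix_mult_def using lim by (auto intro!: vanishing_sum vanishing_mult_left)
    show ?thesis
      unfolding eq using vanishing_diff[OF vanishing_diff[OF lim rest] step]
      by (simp only: vector_minus_component)
  qed
  then have "(mat 1 - N) ** R - mat 1 = 0"
    unfolding vec_eq_iff zero_index using vanishing_all_imp_zero by blast
  moreover have "(R ** (mat 1 - N) - mat 1) $ i $ j \<in> vanishing K" for i j K
  proof -
    have eq: "R ** (mat 1 - N) - mat 1 = (R - S K) - (R - S K) ** N - (S (Suc K) - S K)"
      by (simp add: S_simps matrix_sub_ldistrib matrix_sub_rdistrib commute)
    have rest: "((R - S K) ** N) $ i $ j \<in> vanishing K"
      unfolding matrix_matrix_mult_def using lim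
      by (auto intro!: vanishing_sum vanishing_mult_left simp: mult.commute[of _ "N $ _ $ _"])
    show ?thesis
      unfolding eq using vanishing_diff[OF vanishing_diff[OF lim rest] step]
      by (simp only: vector_minus_component)
  qed
  then have "R ** (mat 1 - N) - mat 1 = 0"
    unfolding vec_eq_iff zero_index using vanishing_all_imp_zero by blast
  ultimately show ?thesis by auto
qed

text \<open>Multiplying \<open>A\<close> by the inverse of its constant part, on either side, leaves a perturbation
  of the identity without constant term, which the geometric series inverts.\<close>

lemma invertible_if_constant_part_invertible:
  fixes A :: "'m::finite mfps ^ 'm ^ 'm"
  assumes "invertible (constant_part A)"
  shows "invertible A"
proof -
  obtain C0 where C0: "constant_part A ** C0 = mat 1" "C0 ** constant_part A = mat 1"
    using assms by (auto simp: invertible_def)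
  define C :: "'m mfps ^ 'm ^ 'm" where "C = (\<chi> i j. mconst (C0 $ i $ j))"
  have C: "constant_part C = C0"
    by (simp add: C_def constant_part_def vec_eq_iff)
  have diff: "constant_part (U - V) = constant_part U - constant_part V" for U V :: "'m mfps ^ 'm ^ 'm"
    by (simp add: constant_part_def vec_eq_iff)
  obtain R where R: "(A ** C) ** R = mat 1"
    using geometric_series_matrix[of "mat 1 - A ** C"] C C0
    by (auto simp: diff constant_part_mult constant_part_mat_1)
  obtain L where L: "L ** (C ** A) = mat 1"
    using geometric_series_matrix[of "mat 1 - C ** A"] C C0
    by (auto simp: diff constant_part_mult constant_part_mat_1)
  have "L ** C = (L ** C) ** (A ** (C ** R))"
    using R by (simp add: matrix_mul_assoc)
  also have "\<dots> = C ** R"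
    using L by (simp add: matrix_mul_assoc)
  finally show ?thesis
    unfolding invertible_def using L R by (metis matrix_mul_assoc)
qed

locale coordinate_frame =
  fixes z :: "'m::finite mfps ^ 'm"
  assumes coords: "formal_coords z"
begin

abbreviation J :: "'m mfps ^ 'm ^ 'm" where "J \<equiv> jacobian z"
abbreviation B :: "'m mfps ^ 'm ^ 'm" where "B \<equiv> matrix_inv J"
abbreviation frame_deriv :: "'m \<Rightarrow> 'm mfps \<Rightarrow> 'm mfps" where "frame_deriv k \<equiv> vf_apply (coord_vf z k)"

lemma constant_part_J: "constant_part J = linear_part z"
  by (simp add: constant_part_def jacobian_def linear_part_def vec_eq_iff mcoeff_pderiv)

lemma J_inverse: "J ** B = mat 1" "B ** J = mat 1"
proof -
  have "invertible J"
    using coords by (intro invertible_if_constant_part_invertible) (simp add: constant_part_J formal_coords_def)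
  then show "J ** B = mat 1" "B ** J = mat 1"
    unfolding invertible_def matrix_inv_def by (metis (mono_tags, lifting) someI_ex)+
qed

lemma J_inverse_nth:
  "(\<Sum>k\<in>UNIV. J $ i $ k * B $ k $ j) = (if i = j then 1 else 0)"
  "(\<Sum>k\<in>UNIV. B $ i $ k * J $ k $ j) = (if i = j then 1 else 0)"
  using J_inverse by (auto simp: matrix_matrix_mult_def mat_def vec_eq_iff)

lemma coord_vf_nth: "coord_vf z k $ j = B $ j $ k"
  by (simp add: coord_vf_def column_def)

lemma vf_apply_coord: "vf_apply V (z $ i) = (\<Sum>k\<in>UNIV. J $ i $ k * V $ k)"
  by (simp add: vf_apply_def jacobian_def mult.commute)

lemma frame_deriv_coord: "frame_deriv k (z $ i) = (if i = k then 1 else 0)"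
  by (simp add: vf_apply_coord coord_vf_nth J_inverse_nth)

lemma vf_component: "V $ j = (\<Sum>k\<in>UNIV. vf_apply V (z $ k) * B $ j $ k)"
proof -
  have "(\<Sum>k\<in>UNIV. vf_apply V (z $ k) * B $ j $ k) = (\<Sum>k\<in>UNIV. \<Sum>l\<in>UNIV. B $ j $ k * J $ k $ l * V $ l)"
    by (simp add: vf_apply_coord sum_distrib_left sum_distrib_right mult_ac)
  also have "\<dots> = (\<Sum>l\<in>UNIV. (\<Sum>k\<in>UNIV. B $ j $ k * J $ k $ l) * V $ l)"
    by (subst sum.swap) (simp add: sum_distrib_right)
  also have "\<dots> = (\<Sum>l\<in>UNIV. if j = l then V $ l else 0)"
    unfolding J_inverse_nth by (rule sum.cong) auto
  finally show ?thesis by simp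
qed

text \<open>As a vector field is determined by its values on the coordinate functions, all commutation
  relations among the vector fields below are checked on the functions \<open>z $ k\<close>.\<close>

lemma vf_eqI: "(\<And>k. vf_apply V (z $ k) = vf_apply W (z $ k)) \<Longrightarrow> V = W"
  unfolding vec_eq_iff using vf_component[of V] vf_component[of W] by simp

text \<open>The chain rule \<open>V = \<Sum>\<^sub>k V(z\<^sub>k) \<partial>/\<partial>z\<^sub>k\<close>.\<close>

lemma vf_apply_frame: "vf_apply V f = (\<Sum>k\<in>UNIV. vf_apply V (z $ k) * frame_deriv k f)"
proof -
  have "V = (\<Sum>k\<in>UNIV. vf_apply V (z $ k) *s coord_vf z k)"
    unfolding vec_eq_iff sum_component by (simp add: coord_vf_nth flip: vf_component)
  then show ?thesis
    using vf_apply_sum_left[of "\<lambda>k. vf_apply V (z $ k) *s coord_vf z k" UNIV f]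
    by (simp add: vf_apply_smult_left)
qed

lemma pderiv_frame: "pderiv_mfps i f = (\<Sum>k\<in>UNIV. J $ k $ i * frame_deriv k f)"
proof -
  have "vf_apply (axis i 1) g = pderiv_mfps i g" for g :: "'m mfps"
    by (simp add: vf_apply_def axis_def if_distrib[of "\<lambda>x. x * _"] cong: if_cong)
  then show ?thesis
    using vf_apply_frame[of "axis i 1" f] by (simp add: jacobian_def)
qed

lemma frame_deriv_bracket: "lie_bracket (coord_vf z j) (coord_vf z k) = 0"
  by (rule vf_eqI) (simp add: vf_apply_lie_bracket frame_deriv_coord, simp add: vf_apply_def)

lemma frame_deriv_commute: "frame_deriv j (frame_deriv k f) = frame_deriv k (frame_deriv j f)"
  using vf_apply_lie_bracket[of "coord_vf z j" "coord_vf z k" f]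
  by (simp add: frame_deriv_bracket vf_apply_def[of 0])

text \<open>This is the vanishing of \<open>[\<partial>/\<partial>z\<^sub>i, \<partial>/\<partial>z\<^sub>k]\<close> in the \<open>j\<close>-th standard component.\<close>

lemma frame_deriv_B: "frame_deriv i (B $ j $ k) = frame_deriv k (B $ j $ i)"
  using frame_deriv_bracket[of i k] by (simp add: lie_bracket_def vec_eq_iff coord_vf_nth)

lemma coord_vanishing: "z $ i \<in> vanishing (Suc 0)"
  using coords by (simp add: formal_coords_def vanishes_at_origin_def vanishing_1)

lemma vanishing_Suc_frame:
  assumes "mcoeff f 0 = 0" "\<And>k. frame_deriv k f \<in> vanishing n"
  shows "f \<in> vanishing (Suc n)"
  using assms
  by (intro vanishing_Suc_pderiv) (auto simp: pderiv_frame intro!: vanishing_sum vanishing_mult_left)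

text \<open>Euler's identity for homogeneous functions, applied to the leading terms of \<open>f\<close>. Differentiating
  the claim for \<open>f\<close> along \<open>\<partial>/\<partial>z\<^sub>i\<close> gives the claim for \<open>\<partial>f/\<partial>z\<^sub>i\<close>, one order lower; no expansion of \<open>f\<close>
  in powers of \<open>z\<close> is needed.\<close>

lemma euler_identity:
  "f \<in> vanishing n \<Longrightarrow> (\<Sum>l\<in>UNIV. z $ l * frame_deriv l f) - mconst (of_nat n) * f \<in> vanishing (Suc n)"
proof (induction n arbitrary: f)
  case 0
  have "z $ l * frame_deriv l f \<in> vanishing (Suc 0)" for l
    using vanishing_mult[OF coord_vanishing vanishing_0] by simp
  then show ?case
    by (simp add: mconst_hom vanishing_sum)
next
  case (Suc n)
  let ?E = "\<lambda>g. \<Sum>l\<in>UNIV. z $ l * frame_deriv l g"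
  show ?case
  proof (rule vanishing_Suc_frame)
    have "mcoeff f 0 = 0" using vanishing_mono[OF Suc.prems] by (simp flip: vanishing_1)
    moreover have "mcoeff (z $ l) 0 = 0" for l
      using coord_vanishing by (simp flip: vanishing_1)
    ultimately show "mcoeff (?E f - mconst (of_nat (Suc n)) * f) 0 = 0"
      by (simp add: mcoeff_sum mcoeff_mult_0)
  next
    fix i
    have "frame_deriv i (z $ l * frame_deriv l f)
        = (if l = i then frame_deriv i f else 0) + z $ l * frame_deriv l (frame_deriv i f)" for l
      by (auto simp: vf_apply_mult frame_deriv_coord frame_deriv_commute[of i])
    then have "frame_deriv i (?E f) = frame_deriv i f + ?E (frame_deriv i f)"
      by (simp add: vf_apply_sum sum.distrib)
    then have "frame_deriv i (?E f - mconst (of_nat (Suc n)) * f)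
        = ?E (frame_deriv i f) - mconst (of_nat n) * frame_deriv i f"
      by (simp add: vf_apply_diff vf_apply_add vf_apply_mconst_mult mconst_hom distrib_right)
    then show "frame_deriv i (?E f - mconst (of_nat (Suc n)) * f) \<in> vanishing (Suc n)"
      using Suc.IH[OF vanishing_vf_apply_Suc[OF Suc.prems]] by simp
  qed
qed

text \<open>Euler's identity exhibits the leading part of \<open>f\<close> as a combination of the coordinates
  with coefficients of one order less. This drives all later inductions on the order of vanishing.\<close>

lemma division:
  assumes "f \<in> vanishing (Suc n)"
  shows "\<exists>h. (\<forall>l. h l \<in> vanishing n) \<and> f - (\<Sum>l\<in>UNIV. z $ l * h l) \<in> vanishing (Suc (Suc n))"
proof (intro exI conjI allI)
  define c where "c = 1 / (of_nat (Suc n) :: complex)"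
  define h where "h l = mconst c * frame_deriv l f" for l
  show "h l \<in> vanishing n" for l
    using assms by (simp add: h_def vanishing_mult_left vanishing_vf_apply_Suc)
  have "mconst c * mconst (of_nat (Suc n)) = (mconst (c * of_nat (Suc n)) :: 'm mfps)"
    by (rule mconst_hom(4)[symmetric])
  also have "c * of_nat (Suc n) = 1"
    unfolding c_def by (simp del: of_nat_Suc)
  finally have "mconst c * mconst (of_nat (Suc n)) = (1 :: 'm mfps)"
    by (simp only: mconst_hom)
  then have "mconst c * (mconst (of_nat (Suc n)) * f) = f"
    by (simp only: mult.assoc[symmetric] mult_1)
  moreover have "(\<Sum>l\<in>UNIV. z $ l * h l) = mconst c * (\<Sum>l\<in>UNIV. z $ l * frame_deriv l f)"
    unfolding h_def sum_distrib_left by (simp only: mult_ac)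
  ultimately have "f - (\<Sum>l\<in>UNIV. z $ l * h l)
      = - (mconst c * ((\<Sum>l\<in>UNIV. z $ l * frame_deriv l f) - mconst (of_nat (Suc n)) * f))"
    by (simp only: right_diff_distrib minus_diff_eq)
  then show "f - (\<Sum>l\<in>UNIV. z $ l * h l) \<in> vanishing (Suc (Suc n))"
    using vanishing_uminus[OF vanishing_mult_left[OF euler_identity[OF assms]]] by simp
qed

lemma vf_apply_diag_vf:
  "vf_apply (diag_vf z c) f = (\<Sum>j\<in>UNIV. mconst (c $ j) * z $ j * frame_deriv j f)"
  by (simp add: diag_vf_def vf_apply_sum_left vf_apply_smult_left)

lemma diag_vf_coord: "vf_apply (diag_vf z c) (z $ i) = mconst (c $ i) * z $ i"
  by (simp add: vf_apply_diag_vf frame_deriv_coord if_distrib[of "\<lambda>x. _ * x"] cong: if_cong)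

text \<open>The field \<open>\<partial>/\<partial>z\<^sub>k\<close> is an eigenvector of weight \<open>- c\<^sub>k\<close> under bracketing with the diagonal field.\<close>

lemma diag_vf_frame_deriv:
  "vf_apply (diag_vf z c) (frame_deriv k f)
    = frame_deriv k (vf_apply (diag_vf z c) f) - mconst (c $ k) * frame_deriv k f"
proof -
  have "lie_bracket (coord_vf z k) (diag_vf z c) = mconst (c $ k) *s coord_vf z k"
    by (rule vf_eqI) (auto simp: vf_apply_lie_bracket vf_apply_smult_left diag_vf_coord
        frame_deriv_coord vf_apply_mconst_mult)
  then show ?thesis
    using vf_apply_lie_bracket[of "coord_vf z k" "diag_vf z c" f] by (simp add: vf_apply_smult_left algebra_simps)
qed

lemma diag_vf_vanishes: "vanishes_at_origin (diag_vf z c)"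
proof -
  have "vf_apply (diag_vf z c) (z $ k) \<in> vanishing (Suc 0)" for k
    unfolding diag_vf_coord by (simp add: vanishing_mult_left coord_vanishing)
  then have "mcoeff (vf_apply (diag_vf z c) (z $ k)) 0 = 0" for k
    by (simp add: vanishing_1)
  then show ?thesis
    unfolding vanishes_at_origin_def
    by (subst vf_component) (simp add: mcoeff_sum mcoeff_mult_0)
qed

end

section \<open>Lie derivatives in the moving frame\<close>

text \<open>A tensor with \<open>n\<close> indices is stored as one array whose index is a function on the natural
  numbers; only its values below \<open>n\<close> matter. Contravariant indices occupy the positions below
  \<open>p\<close>, covariant ones those from \<open>p\<close> on. Compared with a pair of lists, replacing one index becomes a
  function update, and indices at different positions commute without any side condition on lengths.\<close>

type_synonym 'm component_array = "(nat \<Rightarrow> 'm) \<Rightarrow> 'm mfps"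

text \<open>The action of a matrix of power series on the \<open>r\<close>-th index of an array.\<close>

definition slot :: "nat \<Rightarrow> 'm::finite mfps ^ 'm ^ 'm \<Rightarrow> 'm component_array \<Rightarrow> 'm component_array" where
  "slot r Q g = (\<lambda>K. \<Sum>k\<in>UNIV. Q $ K r $ k * g (K(r := k)))"

lemma slot_add: "slot r Q (\<lambda>K. g K + h K) = (\<lambda>K. slot r Q g K + slot r Q h K)"
  by (simp add: slot_def fun_eq_iff distrib_left sum.distrib)

lemma slot_add_left: "slot r (P + Q) g K = slot r P g K + slot r Q g K"
  by (simp add: slot_def fun_eq_iff distrib_right sum.distrib)

lemma slot_zero: "slot r Q (\<lambda>K. 0) = (\<lambda>K. 0)"
  by (simp add: slot_def fun_eq_iff)

lemma slot_sum: "slot r Q (\<lambda>K. \<Sum>x\<in>A. g x K) = (\<lambda>K. \<Sum>x\<in>A. slot r Q (g x) K)"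
  by (induction A rule: infinite_finite_induct) (auto simp: slot_add slot_zero)

lemma slot_slot: "slot r P (slot r Q g) = slot r (P ** Q) g"
proof
  fix K
  have "slot r P (slot r Q g) K = (\<Sum>k\<in>UNIV. \<Sum>l\<in>UNIV. P $ K r $ k * Q $ k $ l * g (K(r := l)))"
    by (simp add: slot_def sum_distrib_left mult.assoc)
  also have "\<dots> = slot r (P ** Q) g K"
    by (subst sum.swap) (simp add: slot_def matrix_matrix_mult_def sum_distrib_right)
  finally show "slot r P (slot r Q g) K = slot r (P ** Q) g K" .
qed

lemma slot_mat_1: "slot r (mat 1) g = g"
  by (simp add: slot_def fun_eq_iff mat_def if_distrib[of "\<lambda>x. x * _"] cong: if_cong)

lemma slot_commute:
  assumes "r \<noteq> s"
  shows "slot r P (slot s Q g) = slot s Q (slot r P g)"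
proof
  fix K
  have "slot r P (slot s Q g) K
      = (\<Sum>k\<in>UNIV. \<Sum>l\<in>UNIV. P $ K r $ k * (Q $ K s $ l * g (K(r := k, s := l))))"
    using assms by (simp add: slot_def sum_distrib_left)
  also have "\<dots> = (\<Sum>l\<in>UNIV. \<Sum>k\<in>UNIV. Q $ K s $ l * (P $ K r $ k * g (K(s := l, r := k))))"
    by (subst sum.swap) (simp add: fun_upd_twist[OF assms] mult.left_commute)
  also have "\<dots> = slot s Q (slot r P g) K"
    using assms by (simp add: slot_def sum_distrib_left)
  finally show "slot r P (slot s Q g) K = slot s Q (slot r P g) K" .
qed

text \<open>The common shape of the Lie derivative in any frame: differentiate every component, and let a
  matrix \<open>M r\<close> act on the \<open>r\<close>-th index.\<close>

definition lie_array ::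
    "'m::finite formal_vf \<Rightarrow> (nat \<Rightarrow> 'm mfps ^ 'm ^ 'm) \<Rightarrow> nat \<Rightarrow> 'm component_array \<Rightarrow> 'm component_array" where
  "lie_array V M n g = (\<lambda>K. vf_apply V (g K) + (\<Sum>r<n. slot r (M r) g K))"

lemma vf_apply_slot:
  "vf_apply V (slot r Q g K) = slot r (\<chi> i j. vf_apply V (Q $ i $ j)) g K + slot r Q (\<lambda>K. vf_apply V (g K)) K"
  by (simp add: slot_def vf_apply_sum vf_apply_mult sum.distrib)

lemma lie_array_Suc: "lie_array V M (Suc n) g = (\<lambda>K. lie_array V M n g K + slot n (M n) g K)"
  by (simp add: lie_array_def add.assoc)

definition flatten :: "nat \<Rightarrow> nat \<Rightarrow> 'm::finite formal_tensor \<Rightarrow> 'm component_array" where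
  "flatten p q G = (\<lambda>K. G (map K [0..<p]) (map K [p..<p + q]))"

definition coord_action :: "nat \<Rightarrow> 'm::finite formal_vf \<Rightarrow> nat \<Rightarrow> 'm mfps ^ 'm ^ 'm" where
  "coord_action p V r = (if r < p then \<chi> i k. - pderiv_mfps k (V $ i) else \<chi> i k. pderiv_mfps i (V $ k))"

text \<open>The recipe defining the Lie derivative has the shape \<open>lie_array\<close>, with minus the Jacobian
  matrix of \<open>V\<close> acting on each contravariant index and its transpose acting on each covariant one.\<close>

lemma flatten_lie_derivative:
  "flatten p q (lie_derivative V G) = lie_array V (coord_action p V) (p + q) (flatten p q G)"
proof
  fix K :: "nat \<Rightarrow> 'a"
  let ?I = "map K [0..<p]" and ?J = "map K [p..<p + q]"
  have up: "map (K(r := k)) [0..<p] = ?I[r := k]" "map (K(r := k)) [p..<p + q] = ?J"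
    if "r < p" for r k
    using that by (auto intro!: nth_equalityI simp: nth_list_update)
  have low: "map (K(p + r := k)) [0..<p] = ?I" "map (K(p + r := k)) [p..<p + q] = ?J[r := k]"
    if "r < q" for r k
    using that by (auto intro!: nth_equalityI simp: nth_list_update)
  have 1: "slot r (coord_action p V r) (flatten p q G) K
      = - (\<Sum>k\<in>UNIV. G (?I[r := k]) ?J * pderiv_mfps k (V $ (?I ! r)))" if "r < p" for r
    using that by (simp add: slot_def coord_action_def flatten_def up sum_negf mult.commute del: map_fun_upd)
  have 2: "slot (p + r) (coord_action p V (p + r)) (flatten p q G) K
      = (\<Sum>k\<in>UNIV. G ?I (?J[r := k]) * pderiv_mfps (?J ! r) (V $ k))" if "r < q" for r
    using that by (simp add: slot_def coord_action_def flatten_def low mult.commute del: map_fun_upd)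
  have "(\<Sum>r<p + q. h r) = (\<Sum>r<p. h r) + (\<Sum>r<q. h (p + r))" for h :: "nat \<Rightarrow> 'a mfps"
    by (induction q) (auto simp: add.assoc)
  then show "flatten p q (lie_derivative V G) K = lie_array V (coord_action p V) (p + q) (flatten p q G) K"
    by (simp add: lie_array_def 1 2 sum_negf)
       (simp add: flatten_def lie_derivative_def)
qed

lemma lie_derivative_eq_zero_iff:
  assumes "G \<in> tensor_fields p q"
  shows "lie_derivative V G = (\<lambda>I J. 0) \<longleftrightarrow> flatten p q (lie_derivative V G) = (\<lambda>K. 0)"
proof
  assume *: "flatten p q (lie_derivative V G) = (\<lambda>K. 0)"
  show "lie_derivative V G = (\<lambda>I J. 0)"
  proof (intro ext)
    fix I J :: "'a list"
    show "lie_derivative V G I J = 0"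
    proof (cases "length I = p \<and> length J = q")
      case True
      have "map (\<lambda>r. (I @ J) ! r) [0..<p] = I" "map (\<lambda>r. (I @ J) ! r) [p..<p + q] = J"
        using True by (auto intro!: nth_equalityI simp: nth_append)
      then show ?thesis
        using fun_cong[OF *, of "\<lambda>r. (I @ J) ! r"] by (simp add: flatten_def)
    next
      case False
      then have "G I' J' = 0" if "length I' = length I" "length J' = length J" for I' J'
        using assms that by (auto simp: tensor_fields_def)
      then show ?thesis by (simp add: lie_derivative_def)
    qed
  qed
qed (simp add: flatten_def fun_eq_iff)

context coordinate_frame
begin

text \<open>The analogue of \<open>coord_action\<close> in the frame of the coordinates \<open>z\<close>: the components \<open>V $ i\<close> become \<open>V(z\<^sub>i)\<close> and
  the partial derivatives become \<open>\<partial>/\<partial>z\<^sub>k\<close>.\<close>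

definition frame_action :: "nat \<Rightarrow> 'm formal_vf \<Rightarrow> nat \<Rightarrow> 'm mfps ^ 'm ^ 'm" where
  "frame_action p V r = (if r < p then \<chi> i k. - frame_deriv k (vf_apply V (z $ i))
     else \<chi> i k. frame_deriv i (vf_apply V (z $ k)))"

text \<open>Contravariant components are evaluations on \<open>dz\<^sub>i\<close>, whose coefficients are the \<open>i\<close>-th row of the
  Jacobian; covariant components are evaluations on \<open>\<partial>/\<partial>z\<^sub>i\<close>, whose coefficients are the \<open>i\<close>-th column of
  its inverse.\<close>

definition transition :: "nat \<Rightarrow> nat \<Rightarrow> 'm mfps ^ 'm ^ 'm" where
  "transition p r = (if r < p then J else transpose B)"

text \<open>How the matrix acting on one index changes with the frame; the derivative of the transition
  matrix compensates for differentiating components in a frame that is not constant. For contravariant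
  indices this is \<open>\<partial>\<^sub>j(V(z\<^sub>i))\<close> expanded by the product rule and by the chain rule; for covariant ones the same is
  done with \<open>\<partial>V\<^sub>j/\<partial>z\<^sub>i\<close>, where the integrability \<open>frame_deriv_B\<close> enters.\<close>

lemma gauge_transformation:
  "frame_action p V r ** transition p r + (\<chi> i j. vf_apply V (transition p r $ i $ j))
    = transition p r ** coord_action p V r"
proof (cases "r < p")
  case True
  have "(\<Sum>k\<in>UNIV. frame_deriv k (vf_apply V (z $ i)) * J $ k $ j)
      = vf_apply V (J $ i $ j) + (\<Sum>k\<in>UNIV. J $ i $ k * pderiv_mfps j (V $ k))" for i j
  proof -
    have "(\<Sum>k\<in>UNIV. frame_deriv k (vf_apply V (z $ i)) * J $ k $ j) = pderiv_mfps j (vf_apply V (z $ i))"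
      by (simp add: pderiv_frame mult.commute)
    also have "\<dots> = (\<Sum>k\<in>UNIV. pderiv_mfps j (J $ i $ k) * V $ k) + (\<Sum>k\<in>UNIV. J $ i $ k * pderiv_mfps j (V $ k))"
      by (simp add: vf_apply_coord pderiv_sum pderiv_mult sum.distrib)
    also have "(\<Sum>k\<in>UNIV. pderiv_mfps j (J $ i $ k) * V $ k) = vf_apply V (J $ i $ j)"
      by (simp add: vf_apply_def jacobian_def mult.commute pderiv_commute[of j])
    finally show ?thesis .
  qed
  then show ?thesis
    using True by (simp add: frame_action_def transition_def coord_action_def matrix_matrix_mult_def
        vec_eq_iff sum_negf)
next
  case False
  have "(\<Sum>k\<in>UNIV. frame_deriv i (vf_apply V (z $ k)) * B $ j $ k) + vf_apply V (B $ j $ i)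
      = (\<Sum>k\<in>UNIV. B $ k $ i * pderiv_mfps k (V $ j))" for i j
  proof -
    have "(\<Sum>k\<in>UNIV. B $ k $ i * pderiv_mfps k (V $ j)) = frame_deriv i (V $ j)"
      by (simp add: vf_apply_def[of "coord_vf z i"] coord_vf_nth)
    also have "\<dots> = (\<Sum>k\<in>UNIV. frame_deriv i (vf_apply V (z $ k)) * B $ j $ k)
        + (\<Sum>k\<in>UNIV. vf_apply V (z $ k) * frame_deriv i (B $ j $ k))"
      by (subst vf_component) (simp add: vf_apply_sum vf_apply_mult sum.distrib)
    also have "(\<Sum>k\<in>UNIV. vf_apply V (z $ k) * frame_deriv i (B $ j $ k)) = vf_apply V (B $ j $ i)"
      unfolding frame_deriv_B[of i] by (rule vf_apply_frame[symmetric])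
    finally show ?thesis by simp
  qed
  then show ?thesis
    using False by (simp add: frame_action_def transition_def coord_action_def matrix_matrix_mult_def
        vec_eq_iff transpose_def)
qed

fun to_frame :: "nat \<Rightarrow> nat \<Rightarrow> 'm component_array \<Rightarrow> 'm component_array" where
  "to_frame p 0 g = g"
| "to_frame p (Suc n) g = slot n (transition p n) (to_frame p n g)"

lemma to_frame_add: "to_frame p n (\<lambda>K. g K + h K) = (\<lambda>K. to_frame p n g K + to_frame p n h K)"
  by (induction n) (auto simp: slot_add)

lemma to_frame_zero: "to_frame p n (\<lambda>K. 0) = (\<lambda>K. 0)"
  by (induction n) (auto simp: slot_zero)

lemma to_frame_slot: "n \<le> r \<Longrightarrow> to_frame p n (slot r Q g) = slot r Q (to_frame p n g)"
proof (induction n)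
  case (Suc n)
  then show ?case by (simp add: slot_commute[of n r])
qed simp

text \<open>Frame changes at different indices commute, so the gauge transformation can be applied to
  one index after the other.\<close>

lemma to_frame_lie_array:
  "to_frame p n (lie_array V (coord_action p V) n g) = lie_array V (frame_action p V) n (to_frame p n g)"
proof (induction n)
  case (Suc n)
  let ?h = "to_frame p n g" and ?Q = "transition p n" and ?L = "lie_array V (frame_action p V) n"
  have "?L (slot n ?Q ?h) = (\<lambda>K. slot n ?Q (?L ?h) K + slot n (\<chi> i j. vf_apply V (?Q $ i $ j)) ?h K)"
    by (simp add: lie_array_def vf_apply_slot slot_add slot_sum slot_commute[of _ n] add_ac)
  then have "lie_array V (frame_action p V) (Suc n) (slot n ?Q ?h) = (\<lambda>K. slot n ?Q (?L ?h) K
      + slot n (frame_action p V n ** ?Q + (\<chi> i j. vf_apply V (?Q $ i $ j))) ?h K)"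
    by (simp add: lie_array_Suc slot_slot slot_add_left add_ac)
  also have "\<dots> = slot n ?Q (\<lambda>K. ?L ?h K + slot n (coord_action p V n) ?h K)"
    by (simp add: gauge_transformation slot_add slot_slot)
  also have "\<dots> = slot n ?Q (to_frame p n (lie_array V (coord_action p V) (Suc n) g))"
    by (simp add: lie_array_Suc Suc to_frame_add to_frame_slot)
  finally show ?case by simp
qed (simp add: lie_array_def)

lemma transition_invertible: "\<exists>R. R ** transition p n = mat 1"
proof (cases "n < p")
  case False
  have "transpose J ** transpose B = mat 1"
    by (simp add: J_inverse transpose_mat flip: matrix_transpose_mul)
  then show ?thesis using False by (auto simp: transition_def)
qed (use J_inverse in \<open>auto simp: transition_def\<close>)

lemma to_frame_eq_zero: "to_frame p n g = (\<lambda>K. 0) \<Longrightarrow> g = (\<lambda>K. 0)"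
proof (induction n)
  case (Suc n)
  obtain R where "R ** transition p n = mat 1" using transition_invertible by blast
  then have "to_frame p n g = slot n R (to_frame p (Suc n) g)"
    by (simp add: slot_slot slot_mat_1)
  then show ?case using Suc by (simp add: slot_zero)
qed simp

definition frame_components :: "nat \<Rightarrow> nat \<Rightarrow> 'm formal_tensor \<Rightarrow> 'm component_array" where
  "frame_components p q G = to_frame p (p + q) (flatten p q G)"

text \<open>The transition matrices are invertible, so a tensor vanishes as soon as its components in the frame
  do. Invariance can therefore be tested in the frame, where the semisimple part is diagonal.\<close>

lemma lie_derivative_zero_iff_frame:
  assumes "G \<in> tensor_fields p q"
  shows "lie_derivative V G = (\<lambda>I J. 0)
    \<longleftrightarrow> lie_array V (frame_action p V) (p + q) (frame_components p q G) = (\<lambda>K. 0)"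
  unfolding lie_derivative_eq_zero_iff[OF assms] flatten_lie_derivative frame_components_def
    to_frame_lie_array[symmetric]
  using to_frame_eq_zero to_frame_zero by metis

end

section \<open>Nilpotency of the Lie derivative along the nilpotent part\<close>

lemma funpow_preserves: "(\<And>x. x \<in> A \<Longrightarrow> F x \<in> A) \<Longrightarrow> x \<in> A \<Longrightarrow> (F ^^ n) x \<in> A"
  by (induction n) auto

lemma funpow_preserves_ge:
  assumes "\<And>x. x \<in> B \<Longrightarrow> F x \<in> B" "(F ^^ a) x \<in> B" "a \<le> n"
  shows "(F ^^ n) x \<in> B"
  using funpow_preserves[of B F "(F ^^ a) x" "n - a"] assms
  by (simp flip: funpow_add[unfolded o_def, THEN fun_cong])

text \<open>In the binomial expansion of a power of \<open>U + V\<close>, each term contains enough factors \<open>U\<close> or enough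
  factors \<open>V\<close> once the exponent reaches \<open>a + b\<close>. Peeling off one factor \<open>U + V\<close> at a time avoids binomial
  coefficients. Nilpotency is relative: it means that a power maps \<open>A\<close> into \<open>B\<close>, as will be the case for
  two consecutive orders of vanishing.\<close>

lemma commuting_nilpotent_sum:
  fixes U V W :: "('b \<Rightarrow> 'a::ab_semigroup_add) \<Rightarrow> 'b \<Rightarrow> 'a"
  assumes W: "\<And>g. W g = (\<lambda>K. U g K + V g K)"
    and U_add: "\<And>g h. U (\<lambda>K. g K + h K) = (\<lambda>K. U g K + U h K)"
    and V_add: "\<And>g h. V (\<lambda>K. g K + h K) = (\<lambda>K. V g K + V h K)"
    and commute: "\<And>g. U (V g) = V (U g)"
    and B_add: "\<And>g h. g \<in> B \<Longrightarrow> h \<in> B \<Longrightarrow> (\<lambda>K. g K + h K) \<in> B"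
    and A: "\<And>g. g \<in> A \<Longrightarrow> U g \<in> A" "\<And>g. g \<in> A \<Longrightarrow> V g \<in> A"
    and B: "\<And>g. g \<in> B \<Longrightarrow> U g \<in> B" "\<And>g. g \<in> B \<Longrightarrow> V g \<in> B"
    and nilpotent: "\<And>g. g \<in> A \<Longrightarrow> (U ^^ a) g \<in> B" "\<And>g. g \<in> A \<Longrightarrow> (V ^^ b) g \<in> B"
    and g: "g \<in> A"
  shows "(W ^^ (a + b)) g \<in> B"
proof -
  have W_add: "(W ^^ n) (\<lambda>K. g K + h K) = (\<lambda>K. (W ^^ n) g K + (W ^^ n) h K)" for n g h
    by (induction n) (auto simp: W U_add V_add add_ac)
  have commute': "V ((U ^^ i) x) = (U ^^ i) (V x)" for i x
    by (induction i) (auto simp flip: commute)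
  have "(W ^^ n) ((U ^^ i) ((V ^^ j) g)) \<in> B" if "a + b \<le> n + i + j" for n i j
    using that
  proof (induction n arbitrary: i j)
    case 0
    show ?case
    proof (cases "a \<le> i")
      case True
      then show ?thesis
        using funpow_preserves_ge[of B U, OF B(1)] nilpotent(1)[OF funpow_preserves[of A V, OF A(2) g]] by auto
    next
      case False
      then have "b \<le> j" using 0 by simp
      then have "(V ^^ j) g \<in> B"
        using funpow_preserves_ge[of B V, OF B(2)] nilpotent(2)[OF g] by auto
      then show ?thesis
        using funpow_preserves[of B U, OF B(1)] by simp
    qed
  next
    case (Suc n)
    have "(W ^^ Suc n) ((U ^^ i) ((V ^^ j) g)) = (W ^^ n) (\<lambda>K. (U ^^ Suc i) ((V ^^ j) g) K + (U ^^ i) ((V ^^ Suc j) g) K)"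
      by (simp add: funpow_Suc_right W commute' del: funpow.simps) (simp add: funpow_swap1)
    also have "\<dots> \<in> B"
      unfolding W_add using Suc.IH[of "Suc i" j] Suc.IH[of i "Suc j"] Suc.prems by (intro B_add) simp_all
    finally show ?case .
  qed
  from this[of "a + b" 0 0] show ?thesis by simp
qed

lemma vf_apply_funpow_add: "(vf_apply V ^^ n) (f + g) = (vf_apply V ^^ n) f + (vf_apply V ^^ n) g"
  by (induction n) (auto simp: vf_apply_add)

lemma vf_apply_funpow_sum: "(vf_apply V ^^ n) (sum f A) = (\<Sum>x\<in>A. (vf_apply V ^^ n) (f x))"
  by (induction n) (auto simp: vf_apply_sum)

text \<open>The Leibniz rule gives the same counting argument for products: a derivative of order \<open>a + b\<close> differentiates
  \<open>u\<close> at least \<open>a\<close> times or \<open>h\<close> at least \<open>b\<close> times in each term.\<close>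

lemma derivation_nilpotent_mult:
  assumes V: "vanishes_at_origin V"
    and u: "u \<in> vanishing j" "(vf_apply V ^^ a) u \<in> vanishing (Suc j)"
    and h: "h \<in> vanishing k" "(vf_apply V ^^ b) h \<in> vanishing (Suc k)"
  shows "(vf_apply V ^^ (a + b)) (u * h) \<in> vanishing (Suc (j + k))"
proof -
  let ?D = "vf_apply V"
  note stable = vanishing_vf_apply[OF V]
  have "(?D ^^ n) ((?D ^^ i) u * (?D ^^ l) h) \<in> vanishing (Suc (j + k))" if "a + b \<le> n + i + l" for n i l
    using that
  proof (induction n arbitrary: i l)
    case 0
    have mem: "(?D ^^ i) u \<in> vanishing j" "(?D ^^ l) h \<in> vanishing k"
      using u h by (auto intro: funpow_preserves stable)
    show ?case
    proof (cases "a \<le> i")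
      case True
      then have "(?D ^^ i) u \<in> vanishing (Suc j)"
        using u by (auto intro: funpow_preserves_ge stable)
      then show ?thesis using vanishing_mult[OF _ mem(2)] by fastforce
    next
      case False
      then have "(?D ^^ l) h \<in> vanishing (Suc k)"
        using h 0 by (auto intro: funpow_preserves_ge[of _ _ b] stable)
      then show ?thesis using vanishing_mult[OF mem(1)] by fastforce
    qed
  next
    case (Suc n)
    have "(?D ^^ Suc n) ((?D ^^ i) u * (?D ^^ l) h)
        = (?D ^^ n) ((?D ^^ Suc i) u * (?D ^^ l) h) + (?D ^^ n) ((?D ^^ i) u * (?D ^^ Suc l) h)"
      unfolding funpow_Suc_right[of n] o_apply vf_apply_mult vf_apply_funpow_add by simp
    also have "\<dots> \<in> vanishing (Suc (j + k))"
      using Suc.IH[of "Suc i" l] Suc.IH[of i "Suc l"] Suc.prems by (intro vanishing_add) simp_all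
    finally show ?case .
  qed
  from this[of "a + b" 0 0] show ?thesis by simp
qed

abbreviation matpow :: "'a::semiring_1 ^ 'm ^ 'm::finite \<Rightarrow> nat \<Rightarrow> 'a ^ 'm ^ 'm" where
  "matpow N k \<equiv> (((**) N) ^^ k) (mat 1)"

lemma matpow_Suc_right: "matpow N (Suc k) = matpow N k ** N"
  by (induction k) (simp_all add: matrix_mul_assoc)

lemma nilpotent_mat_conjugate:
  fixes N P Q :: "complex ^ 'm ^ 'm::finite"
  assumes "nilpotent_mat N" "Q ** P = mat 1" "P ** Q = mat 1"
  shows "nilpotent_mat (P ** N ** Q)"
proof -
  have "matpow (P ** N ** Q) k = P ** matpow N k ** Q" for k
  proof (induction k)
    case (Suc k)
    have "matpow (P ** N ** Q) (Suc k) = P ** N ** (Q ** P) ** matpow N k ** Q"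
      by (simp add: Suc matrix_mul_assoc)
    then show ?case by (simp add: assms(2) matrix_mul_assoc)
  qed (simp add: assms)
  moreover have "P ** 0 ** Q = 0"
    by (simp add: matrix_matrix_mult_def vec_eq_iff)
  ultimately show ?thesis using assms(1) unfolding nilpotent_mat_def by metis
qed

lemma nilpotent_mat_uminus:
  fixes N :: "complex ^ 'm ^ 'm::finite"
  assumes "nilpotent_mat N"
  shows "nilpotent_mat (- N)"
proof -
  have "matpow (- N) k = (-1) ^ k *\<^sub>R matpow N k" for k
  proof (induction k)
    case (Suc k)
    have "(- N) ** (c *\<^sub>R R) = (- c) *\<^sub>R (N ** R)" for c and R :: "complex ^ 'm ^ 'm"
      by (simp add: matrix_matrix_mult_def vec_eq_iff sum_negf scaleR_sum_right)
    then show ?case by (simp add: Suc)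
  qed simp
  then show ?thesis using assms by (auto simp: nilpotent_mat_def)
qed

lemma nilpotent_mat_transpose:
  fixes N :: "complex ^ 'm ^ 'm::finite"
  assumes "nilpotent_mat N"
  shows "nilpotent_mat (transpose N)"
proof -
  have "matpow (transpose N) k = transpose (matpow N k)" for k
  proof (induction k)
    case (Suc k)
    then show ?case unfolding matpow_Suc_right[where N = N] by (simp add: matrix_transpose_mul)
  qed (simp add: transpose_mat)
  moreover have "transpose 0 = (0 :: complex ^ 'm ^ 'm)"
    by (simp add: transpose_def vec_eq_iff)
  ultimately show ?thesis using assms unfolding nilpotent_mat_def by metis
qed

definition const_mat :: "complex ^ 'm ^ 'm \<Rightarrow> 'm::finite mfps ^ 'm ^ 'm" where
  "const_mat N = (\<chi> i j. mconst (N $ i $ j))"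

lemma const_mat_hom: "const_mat (mat 1) = mat 1" "const_mat 0 = 0" "const_mat (M ** N) = const_mat M ** const_mat N"
  by (simp_all add: const_mat_def vec_eq_iff mat_def mconst_hom matrix_matrix_mult_def mconst_sum)

lemma slot_const_nilpotent:
  assumes "nilpotent_mat N"
  shows "\<exists>a. \<forall>g. (slot r (const_mat N) ^^ a) g = (\<lambda>K. 0)"
proof -
  have "(slot r (const_mat N) ^^ k) g = slot r (const_mat (matpow N k)) g" for k g
    by (induction k) (simp_all add: const_mat_hom slot_mat_1 slot_slot)
  moreover have "slot r (const_mat 0) g = (\<lambda>K. 0)" for g
    by (simp add: const_mat_hom slot_def)
  ultimately show ?thesis
    using assms unfolding nilpotent_mat_def by metis
qed

definition vanishing_arrays :: "nat \<Rightarrow> ('m::finite component_array) set" where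
  "vanishing_arrays k = {g. \<forall>K. g K \<in> vanishing k}"

lemma slot_vanishing: "g \<in> vanishing_arrays k \<Longrightarrow> slot r Q g \<in> vanishing_arrays k"
  by (simp add: vanishing_arrays_def slot_def vanishing_sum vanishing_mult_left)

lemma lie_array_vanishing:
  "vanishes_at_origin V \<Longrightarrow> g \<in> vanishing_arrays k \<Longrightarrow> lie_array V M n g \<in> vanishing_arrays k"
  using slot_vanishing[of g k]
  by (simp add: vanishing_arrays_def lie_array_def vanishing_add vanishing_sum vanishing_vf_apply)

lemma lie_array_add: "lie_array V M n (\<lambda>K. g K + h K) = (\<lambda>K. lie_array V M n g K + lie_array V M n h K)"
  by (simp add: lie_array_def vf_apply_add slot_add sum.distrib add_ac)

text \<open>With constant matrices, the derivation and the actions on the individual indices commute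
  exactly, and each of them is nilpotent from one order of vanishing to the next.\<close>

lemma lie_array_const_nilpotent:
  assumes V: "vanishes_at_origin V"
    and nil_functions: "\<exists>a. \<forall>f\<in>vanishing k. (vf_apply V ^^ a) f \<in> vanishing (Suc k)"
    and N: "\<And>r. nilpotent_mat (N r)"
  shows "\<exists>a. \<forall>g\<in>vanishing_arrays k. (lie_array V (\<lambda>r. const_mat (N r)) n ^^ a) g \<in> vanishing_arrays (Suc k)"
proof (induction n)
  case 0
  have "(lie_array V (\<lambda>r. const_mat (N r)) 0 ^^ a) g = (\<lambda>K. (vf_apply V ^^ a) (g K))" for a g
    by (induction a) (simp_all add: lie_array_def)
  then show ?case using nil_functions by (simp add: vanishing_arrays_def) blast
next
  case (Suc n)
  let ?M = "\<lambda>r. const_mat (N r)"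
  obtain a where a: "\<And>g. g \<in> vanishing_arrays k \<Longrightarrow> (lie_array V ?M n ^^ a) g \<in> vanishing_arrays (Suc k)"
    using Suc by blast
  obtain b where b: "\<And>g. (slot n (?M n) ^^ b) g = (\<lambda>K. 0)"
    using slot_const_nilpotent[OF N] by blast
  have "slot n (\<chi> i j. vf_apply V (?M n $ i $ j)) g K = 0" for g K
    by (simp add: slot_def const_mat_def)
  then have commute: "lie_array V ?M n (slot n (?M n) g) = slot n (?M n) (lie_array V ?M n g)" for g
    by (simp add: lie_array_def vf_apply_slot slot_add slot_sum slot_commute[of _ n])
  have "(lie_array V ?M (Suc n) ^^ (a + b)) g \<in> vanishing_arrays (Suc k)" if "g \<in> vanishing_arrays k" for g
  proof (rule commuting_nilpotent_sum[where U = "lie_array V ?M n" and V = "slot n (?M n)"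
        and A = "vanishing_arrays k"])
    show "(slot n (?M n) ^^ b) h \<in> vanishing_arrays (Suc k)" for h
      by (simp add: b vanishing_arrays_def)
  qed (use a that commute V in \<open>auto simp: lie_array_Suc lie_array_add slot_add slot_vanishing lie_array_vanishing\<close>,
      auto simp: vanishing_arrays_def vanishing_add)
  then show ?case by blast
qed

text \<open>Replacing each matrix by its constant part changes the operator only by terms that raise the
  order of vanishing.\<close>

lemma lie_array_nilpotent_step:
  assumes V: "vanishes_at_origin V"
    and nil_functions: "\<exists>a. \<forall>f\<in>vanishing k. (vf_apply V ^^ a) f \<in> vanishing (Suc k)"
    and M: "\<And>r. nilpotent_mat (constant_part (M r))"
  shows "\<exists>a. \<forall>g\<in>vanishing_arrays k. (lie_array V M n ^^ a) g \<in> vanishing_arrays (Suc k)"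
proof -
  let ?L = "lie_array V M n" and ?C = "lie_array V (\<lambda>r. const_mat (constant_part (M r))) n"
  have entry: "M r $ i $ j - const_mat (constant_part (M r)) $ i $ j \<in> vanishing 1" for r i j
    by (simp add: vanishing_1 const_mat_def constant_part_def)
  have "(\<lambda>K. slot r (M r) g K - slot r (const_mat (constant_part (M r))) g K) \<in> vanishing_arrays (Suc k)"
    if "g \<in> vanishing_arrays k" for g r
    using that vanishing_mult[OF entry]
    by (auto simp: slot_def vanishing_arrays_def simp flip: sum_subtractf left_diff_distrib intro!: vanishing_sum)
  then have diff: "?L g K - ?C g K \<in> vanishing (Suc k)" if "g \<in> vanishing_arrays k" for g K
    using that by (auto simp: lie_array_def vanishing_arrays_def simp flip: sum_subtractf intro!: vanishing_sum)
  have "(?L ^^ a) g K - (?C ^^ a) g K \<in> vanishing (Suc k)" if g: "g \<in> vanishing_arrays k" for g K a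
  proof (induction a arbitrary: K)
    case (Suc a)
    let ?e = "\<lambda>K. (?L ^^ a) g K - (?C ^^ a) g K"
    have "?L ((?L ^^ a) g) = (\<lambda>K. ?L ?e K + ?L ((?C ^^ a) g) K)"
      using lie_array_add[of V M n ?e "(?C ^^ a) g"] by simp
    moreover have "?L ?e K \<in> vanishing (Suc k)"
      using lie_array_vanishing[OF V, of ?e "Suc k" M n] Suc.IH by (simp add: vanishing_arrays_def)
    moreover have "(?C ^^ a) g \<in> vanishing_arrays k"
      using g V by (auto intro: funpow_preserves lie_array_vanishing)
    then have "?L ((?C ^^ a) g) K - ?C ((?C ^^ a) g) K \<in> vanishing (Suc k)"
      by (rule diff)
    ultimately show ?case
      using vanishing_add by (fastforce simp: add_diff_eq[symmetric])
  qed simp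
  moreover obtain a where "\<And>g. g \<in> vanishing_arrays k \<Longrightarrow> (?C ^^ a) g \<in> vanishing_arrays (Suc k)"
    using lie_array_const_nilpotent[OF V nil_functions, of "\<lambda>r. constant_part (M r)" n] M by blast
  ultimately have "(?L ^^ a) g K \<in> vanishing (Suc k)" if "g \<in> vanishing_arrays k" for g K
    using that vanishing_add[of "(?L ^^ a) g K - (?C ^^ a) g K" "Suc k" "(?C ^^ a) g K"]
    by (simp add: vanishing_arrays_def)
  then show ?thesis by (auto simp: vanishing_arrays_def)
qed

context coordinate_frame
begin

text \<open>The matrix of the linear part of \<open>V\<close> in the coordinates \<open>z\<close>.\<close>

definition frame_linear_part :: "'m formal_vf \<Rightarrow> complex ^ 'm ^ 'm" where
  "frame_linear_part V = (\<chi> i k. mcoeff (frame_deriv k (vf_apply V (z $ i))) 0)"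

text \<open>Modulo quadratic terms, \<open>V\<close> acts on the span of the coordinates by its linear part.\<close>

lemma vf_apply_funpow_coord:
  assumes V: "vanishes_at_origin V"
  shows "(vf_apply V ^^ a) (z $ i) - (\<Sum>k\<in>UNIV. mconst (matpow (frame_linear_part V) a $ i $ k) * z $ k)
    \<in> vanishing (Suc (Suc 0))"
proof (induction a)
  case 0
  show ?case
    by (simp add: mat_def mconst_hom if_distrib[of mconst] if_distrib[of "\<lambda>x. x * _"] cong: if_cong)
next
  case (Suc a)
  let ?N = "frame_linear_part V" and ?D = "vf_apply V"
  let ?lin = "\<lambda>c. \<Sum>k\<in>UNIV. mconst (c k) * z $ k"
  have linear: "?D (z $ k) - ?lin (\<lambda>l. ?N $ k $ l) \<in> vanishing (Suc (Suc 0))" for k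
  proof (rule vanishing_Suc_frame)
    have "mcoeff (z $ l) 0 = 0" "mcoeff (?D (z $ l)) 0 = 0" for l
      using coord_vanishing vanishing_vf_apply[OF V coord_vanishing] by (simp_all flip: vanishing_1)
    then show "mcoeff (?D (z $ k) - ?lin (\<lambda>l. ?N $ k $ l)) 0 = 0"
      by (simp add: mcoeff_sum)
    show "frame_deriv j (?D (z $ k) - ?lin (\<lambda>l. ?N $ k $ l)) \<in> vanishing (Suc 0)" for j
      by (simp add: vf_apply_diff vf_apply_sum vf_apply_mconst_mult frame_deriv_coord vanishing_1
          frame_linear_part_def if_distrib[of "\<lambda>x. _ * x"] cong: if_cong)
  qed
  let ?P = "matpow ?N a"
  have "?lin (\<lambda>k. matpow ?N (Suc a) $ i $ k) = (\<Sum>k\<in>UNIV. \<Sum>l\<in>UNIV. mconst (?P $ i $ l) * (mconst (?N $ l $ k) * z $ k))"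
    unfolding matpow_Suc_right
    by (simp add: matrix_matrix_mult_def mconst_sum mconst_hom sum_distrib_right mult.assoc)
  also have "\<dots> = (\<Sum>l\<in>UNIV. mconst (?P $ i $ l) * ?lin (\<lambda>k. ?N $ l $ k))"
    by (subst sum.swap) (simp add: sum_distrib_left)
  finally have "?D ((?D ^^ a) (z $ i)) - ?lin (\<lambda>k. matpow ?N (Suc a) $ i $ k)
      = ?D ((?D ^^ a) (z $ i) - ?lin (\<lambda>k. ?P $ i $ k))
        + (\<Sum>l\<in>UNIV. mconst (?P $ i $ l) * (?D (z $ l) - ?lin (\<lambda>k. ?N $ l $ k)))"
    by (simp only: vf_apply_diff vf_apply_sum vf_apply_mconst_mult right_diff_distrib sum_subtractf) simp
  also have "\<dots> \<in> vanishing (Suc (Suc 0))"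
    using Suc linear by (intro vanishing_add vanishing_vf_apply[OF V] vanishing_sum vanishing_mult_left)
  finally show ?case by simp
qed

text \<open>By \<open>division\<close>, functions of order \<open>k + 1\<close> are, to leading order, products of a coordinate and a function of
  order \<open>k\<close>; nilpotency on both factors passes to the product.\<close>

lemma derivation_nilpotent_on_functions:
  assumes V: "vanishes_at_origin V" and N: "nilpotent_mat (frame_linear_part V)"
  shows "\<exists>a. \<forall>f\<in>vanishing k. (vf_apply V ^^ a) f \<in> vanishing (Suc k)"
proof (induction k)
  case 0
  have "vf_apply V f \<in> vanishing (Suc 0)" for f
    using V by (simp add: vanishing_1 vf_apply_def mcoeff_sum mcoeff_mult_0 vanishes_at_origin_def)
  then have "\<forall>f\<in>vanishing 0. (vf_apply V ^^ 1) f \<in> vanishing (Suc 0)" by simp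
  then show ?case by blast
next
  case (Suc k)
  obtain a where "matpow (frame_linear_part V) a = 0"
    using N by (auto simp: nilpotent_mat_def)
  then have a: "(vf_apply V ^^ a) (z $ i) \<in> vanishing (Suc (Suc 0))" for i
    using vf_apply_funpow_coord[OF V, of a i] by (simp add: mconst_hom)
  obtain b where b: "\<And>f. f \<in> vanishing k \<Longrightarrow> (vf_apply V ^^ b) f \<in> vanishing (Suc k)"
    using Suc by blast
  have "(vf_apply V ^^ (a + b)) f \<in> vanishing (Suc (Suc k))" if f: "f \<in> vanishing (Suc k)" for f
  proof -
    obtain h where h: "\<And>l. h l \<in> vanishing k" "f - (\<Sum>l\<in>UNIV. z $ l * h l) \<in> vanishing (Suc (Suc k))"
      using division[OF f] by blast
    have "(vf_apply V ^^ (a + b)) (z $ l * h l) \<in> vanishing (Suc (Suc k))" for l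
      using derivation_nilpotent_mult[OF V coord_vanishing a h(1) b[OF h(1)]] by simp
    then have "(vf_apply V ^^ (a + b)) (\<Sum>l\<in>UNIV. z $ l * h l) \<in> vanishing (Suc (Suc k))"
      by (simp add: vf_apply_funpow_sum vanishing_sum)
    moreover have "(vf_apply V ^^ (a + b)) (f - (\<Sum>l\<in>UNIV. z $ l * h l)) \<in> vanishing (Suc (Suc k))"
      using h(2) V by (auto intro: funpow_preserves vanishing_vf_apply)
    ultimately have "(vf_apply V ^^ (a + b)) ((f - (\<Sum>l\<in>UNIV. z $ l * h l)) + (\<Sum>l\<in>UNIV. z $ l * h l))
        \<in> vanishing (Suc (Suc k))"
      unfolding vf_apply_funpow_add by (rule vanishing_add[rotated])
    then show ?thesis by simp
  qed
  then show ?case by blast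
qed

lemma constant_part_frame_action:
  "constant_part (frame_action p V r)
    = (if r < p then - frame_linear_part V else transpose (frame_linear_part V))"
  by (simp add: constant_part_def frame_action_def frame_linear_part_def transpose_def vec_eq_iff)

lemma lie_array_topologically_nilpotent:
  assumes V: "vanishes_at_origin V" and N: "nilpotent_mat (frame_linear_part V)"
  shows "\<exists>a. \<forall>g. (lie_array V (frame_action p V) n ^^ a) g \<in> vanishing_arrays k"
proof (induction k)
  case 0
  show ?case by (simp add: vanishing_arrays_def)
next
  case (Suc k)
  let ?L = "lie_array V (frame_action p V) n"
  have "nilpotent_mat (constant_part (frame_action p V r))" for r
    using N by (simp add: constant_part_frame_action nilpotent_mat_uminus nilpotent_mat_transpose)
  then obtain b where b: "\<And>g. g \<in> vanishing_arrays k \<Longrightarrow> (?L ^^ b) g \<in> vanishing_arrays (Suc k)"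
    using lie_array_nilpotent_step[OF V derivation_nilpotent_on_functions[OF V N]] by blast
  obtain a where a: "\<And>g. (?L ^^ a) g \<in> vanishing_arrays k"
    using Suc by blast
  have "(?L ^^ (b + a)) g \<in> vanishing_arrays (Suc k)" for g
    using b[OF a] by (simp add: funpow_add)
  then show ?case by blast
qed

end

section \<open>Minimal toric decompositions\<close>

text \<open>An integer relation with \<open>b e \<noteq> 0\<close> allows \<open>lam e\<close> to be eliminated. Dividing the other
  coefficients by \<open>b e\<close> and multiplying the fields by it keeps the fields integral, so one gets
  a decomposition with fewer terms.\<close>

lemma minimal_decomposition_independent:
  assumes dec: "toric_decomposition c d lam a"
    and minimal: "\<And>d' lam' a'. d' < d \<Longrightarrow> \<not> toric_decomposition c d' lam' a'"
    and relation: "(\<Sum>i<d. lam i * of_int (b i)) = 0"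
    and e: "e < d"
  shows "b e = 0"
proof (rule ccontr)
  assume be: "b e \<noteq> 0"
  obtain h where h: "bij_betw h {..<d - 1} ({..<d} - {e})"
    using ex_bij_betw_nat_finite[of "{..<d} - {e}"] e by (auto simp: atLeast0LessThan)
  define lam' where "lam' i = lam (h i) / of_int (b e)" for i
  define a' :: "nat \<Rightarrow> int ^ 'a" where "a' i = (\<chi> j. b e * a (h i) $ j - b (h i) * a e $ j)" for i
  have "toric_decomposition c (d - 1) lam' a'"
    unfolding toric_decomposition_def
  proof
    fix j
    let ?t = "\<lambda>i. lam i / of_int (b e) * of_int (b e * a i $ j - b i * a e $ j)"
    have "(\<Sum>i<d - 1. lam' i * of_int (a' i $ j)) = (\<Sum>i<d - 1. ?t (h i))"
      by (simp add: lam'_def a'_def)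
    also have "\<dots> = (\<Sum>i\<in>{..<d} - {e}. ?t i)"
      by (rule sum.reindex_bij_betw[OF h])
    also have "\<dots> = (\<Sum>i<d. ?t i)"
      using e by (intro sum.mono_neutral_left) auto
    also have "\<dots> = (\<Sum>i<d. lam i * of_int (a i $ j))
        - of_int (a e $ j) / of_int (b e) * (\<Sum>i<d. lam i * of_int (b i))"
      unfolding sum_distrib_left sum_subtractf[symmetric] using be
      by (intro sum.cong) (auto simp: field_simps)
    also have "\<dots> = c $ j"
      using dec relation by (simp add: toric_decomposition_def)
    finally show "c $ j = (\<Sum>i<d - 1. lam' i * of_int (a' i $ j))" by simp
  qed
  moreover have "d - 1 < d" using e by simp
  ultimately show False using minimal by blast
qed

section \<open>Eigenvectors modulo high order\<close>

text \<open>In the frame of \<open>z\<close>, diagonal fields act on single tensor components by such operators, the shift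
  \<open>w\<close> being the weight of the component.\<close>

definition shifted_deriv :: "'m::finite formal_vf \<Rightarrow> complex \<Rightarrow> 'm mfps \<Rightarrow> 'm mfps" where
  "shifted_deriv V w f = vf_apply V f + mconst w * f"

lemma shifted_deriv_add: "shifted_deriv V w (f + g) = shifted_deriv V w f + shifted_deriv V w g"
  by (simp add: shifted_deriv_def vf_apply_add algebra_simps)

lemma shifted_deriv_zero: "shifted_deriv V w 0 = 0"
  by (simp add: shifted_deriv_def)

lemma shifted_deriv_sum: "shifted_deriv V w (sum f A) = (\<Sum>x\<in>A. shifted_deriv V w (f x))"
  by (induction A rule: infinite_finite_induct) (auto simp: shifted_deriv_add shifted_deriv_zero)

lemma shifted_deriv_mconst: "shifted_deriv V w (mconst c * f) = mconst c * shifted_deriv V w f"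
  by (simp add: shifted_deriv_def vf_apply_mconst_mult distrib_left mult.left_commute)

lemma shifted_deriv_vanishing:
  "vanishes_at_origin V \<Longrightarrow> f \<in> vanishing k \<Longrightarrow> shifted_deriv V w f \<in> vanishing k"
  by (simp add: shifted_deriv_def vanishing_add vanishing_vf_apply vanishing_mult_left)

lemma mconst_cancel:
  assumes "c \<noteq> 0" "mconst c * f \<in> vanishing k"
  shows "f \<in> vanishing k"
proof -
  have "mconst (1 / c) * (mconst c * f) = mconst (1 / c * c) * f"
    by (simp only: mconst_hom mult.assoc)
  then have "f = mconst (1 / c) * (mconst c * f)"
    using assms(1) by (simp add: mconst_hom)
  then show ?thesis using vanishing_mult_left[OF assms(2)] by metis
qed

text \<open>Eigenvectors for distinct eigenvalues are linearly independent, also modulo the invariant subspace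
  \<open>vanishing k\<close>: applying \<open>T - \<nu>\<close> removes one summand.\<close>

lemma eigenvector_separation:
  assumes V: "vanishes_at_origin V" and "finite M"
    and "\<And>\<mu>. \<mu> \<in> M \<Longrightarrow> shifted_deriv V w (y \<mu>) = mconst \<mu> * y \<mu>"
    and "(\<Sum>\<mu>\<in>M. y \<mu>) \<in> vanishing k" and "\<mu> \<in> M"
  shows "y \<mu> \<in> vanishing k"
  using assms(2-)
proof (induction M arbitrary: y \<mu> rule: finite_induct)
  case (insert \<nu> M)
  let ?T = "shifted_deriv V w"
  have "?T (\<Sum>\<mu>\<in>insert \<nu> M. y \<mu>) - mconst \<nu> * (\<Sum>\<mu>\<in>insert \<nu> M. y \<mu>)
      = (\<Sum>\<mu>\<in>insert \<nu> M. mconst (\<mu> - \<nu>) * y \<mu>)"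
    unfolding shifted_deriv_sum sum_distrib_left sum_subtractf[symmetric]
    using insert.prems(1) by (intro sum.cong) (auto simp: mconst_hom algebra_simps)
  also have "\<dots> = (\<Sum>\<mu>\<in>M. mconst (\<mu> - \<nu>) * y \<mu>)"
    using insert.hyps by (simp add: mconst_hom)
  finally have eq: "?T (\<Sum>\<mu>\<in>insert \<nu> M. y \<mu>) - mconst \<nu> * (\<Sum>\<mu>\<in>insert \<nu> M. y \<mu>)
      = (\<Sum>\<mu>\<in>M. mconst (\<mu> - \<nu>) * y \<mu>)" .
  have "(\<Sum>\<mu>\<in>M. mconst (\<mu> - \<nu>) * y \<mu>) \<in> vanishing k"
    unfolding eq[symmetric]
    by (intro vanishing_diff shifted_deriv_vanishing V vanishing_mult_left insert.prems(2))
  then have "mconst (\<mu> - \<nu>) * y \<mu> \<in> vanishing k" if "\<mu> \<in> M" for \<mu>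
    using that insert.prems(1)
    by (intro insert.IH[where y = "\<lambda>\<mu>. mconst (\<mu> - \<nu>) * y \<mu>" and \<mu> = \<mu>])
      (auto simp: shifted_deriv_mconst mult.left_commute)
  then have M: "y \<mu> \<in> vanishing k" if "\<mu> \<in> M" for \<mu>
    using that insert.hyps(2) mconst_cancel[of "\<mu> - \<nu>" "y \<mu>" k] by auto
  have "y \<nu> = (\<Sum>\<mu>\<in>insert \<nu> M. y \<mu>) - (\<Sum>\<mu>\<in>M. y \<mu>)"
    using insert.hyps by simp
  also have "\<dots> \<in> vanishing k"
    using M by (intro vanishing_diff[OF insert.prems(2)] vanishing_sum)
  finally show ?case using M insert.prems(3) by auto
qed simp

definition int_vec :: "int ^ 'm \<Rightarrow> complex ^ 'm" where
  "int_vec v = (\<chi> j. of_int (v $ j))"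

context coordinate_frame
begin

text \<open>Finite sums of joint eigenvectors of the torus generators with integer eigenvalues. All
  polynomials in \<open>z\<close> belong to this span.\<close>

inductive_set eigen_span :: "(nat \<Rightarrow> int ^ 'm) \<Rightarrow> 'm mfps set" for a where
  eigenvector: "(\<And>i. vf_apply (diag_vf z (int_vec (a i))) f = mconst (of_int (v i)) * f) \<Longrightarrow> f \<in> eigen_span a"
| add: "f \<in> eigen_span a \<Longrightarrow> g \<in> eigen_span a \<Longrightarrow> f + g \<in> eigen_span a"

lemma eigen_span_mconst: "mconst c \<in> eigen_span a"
  by (rule eigen_span.eigenvector[where v = "\<lambda>i. 0"]) (simp add: mconst_hom)

lemma eigen_span_coord_mult: "f \<in> eigen_span a \<Longrightarrow> z $ l * f \<in> eigen_span a"
proof (induction rule: eigen_span.induct)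
  case (eigenvector f v)
  then show ?case
    by (intro eigen_span.eigenvector[where v = "\<lambda>i. a i $ l + v i"])
      (simp add: vf_apply_mult diag_vf_coord int_vec_def mconst_hom algebra_simps)
next
  case (add f g)
  then show ?case by (simp add: distrib_left eigen_span.add)
qed

lemma eigen_span_sum: "(\<And>x. x \<in> A \<Longrightarrow> f x \<in> eigen_span a) \<Longrightarrow> sum f A \<in> eigen_span a"
  using eigen_span_mconst[of 0]
  by (induction A rule: infinite_finite_induct) (auto simp: mconst_hom intro: eigen_span.add)

lemma eigen_span_leading:
  "f \<in> vanishing k \<Longrightarrow> \<exists>s\<in>eigen_span a. f - s \<in> vanishing (Suc k)"
proof (induction k arbitrary: f)
  case 0
  have "f - mconst (mcoeff f 0) \<in> vanishing (Suc 0)" by (simp add: vanishing_1)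
  then show ?case using eigen_span_mconst by blast
next
  case (Suc k)
  obtain h where h: "\<And>l. h l \<in> vanishing k" "f - (\<Sum>l\<in>UNIV. z $ l * h l) \<in> vanishing (Suc (Suc k))"
    using division[OF Suc.prems] by blast
  obtain s where s: "\<And>l. s l \<in> eigen_span a" "\<And>l. h l - s l \<in> vanishing (Suc k)"
    using Suc.IH[OF h(1)] by metis
  have "(\<Sum>l\<in>UNIV. z $ l * (h l - s l)) \<in> vanishing (Suc (Suc k))"
    using vanishing_mult[OF coord_vanishing s(2)] by (auto intro: vanishing_sum)
  then have "f - (\<Sum>l\<in>UNIV. z $ l * s l) \<in> vanishing (Suc (Suc k))"
    using vanishing_add[OF h(2)] by (fastforce simp: right_diff_distrib sum_subtractf)
  then show ?case
    using s(1) by (blast intro: eigen_span_sum eigen_span_coord_mult)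
qed

text \<open>An approximation is improved one order at a time, by approximating the leading part of its error.\<close>

lemma eigen_span_dense: "\<exists>s\<in>eigen_span a. f - s \<in> vanishing k"
proof (induction k)
  case 0
  show ?case using eigen_span_mconst by auto
next
  case (Suc k)
  then obtain s where s: "s \<in> eigen_span a" "f - s \<in> vanishing k" by blast
  obtain t where "t \<in> eigen_span a" "(f - s) - t \<in> vanishing (Suc k)"
    using eigen_span_leading[OF s(2)] by blast
  then show ?case
    using s(1) by (intro bexI[of _ "s + t"]) (auto simp: diff_diff_eq intro: eigen_span.add)
qed

lemma diag_vf_decomposition:
  assumes "toric_decomposition c d lam a"
  shows "vf_apply (diag_vf z c) f = (\<Sum>i<d. mconst (lam i) * vf_apply (diag_vf z (int_vec (a i))) f)"
proof -
  have "vf_apply (diag_vf z c) f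
      = (\<Sum>j\<in>UNIV. \<Sum>i<d. mconst (lam i) * (mconst (of_int (a i $ j)) * z $ j * frame_deriv j f))"
    using assms by (simp add: vf_apply_diag_vf toric_decomposition_def mconst_sum mconst_hom
        sum_distrib_right mult.assoc)
  also have "\<dots> = (\<Sum>i<d. mconst (lam i) * vf_apply (diag_vf z (int_vec (a i))) f)"
    by (subst sum.swap) (simp add: vf_apply_diag_vf int_vec_def sum_distrib_left)
  finally show ?thesis .
qed

text \<open>The joint eigenvectors are grouped by the eigenvalue \<open>\<mu>\<close> of the shifted semisimple operator. The
  last clause is where incommensurability enters: \<open>\<mu> = 0\<close> forces every integer eigenvalue to vanish. The
  summands are taken to be zero outside the finite set \<open>M\<close> so that two decompositions can be added
  pointwise.\<close>

lemma eigen_span_decompose: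
  assumes dec: "toric_decomposition c d lam a"
    and indep: "\<forall>b. (\<Sum>i<d. lam i * of_int (b i)) = 0 \<longrightarrow> (\<forall>i<d. b i = 0)"
    and "s \<in> eigen_span a"
  shows "\<exists>M y. finite M \<and> (\<forall>\<mu>. \<mu> \<notin> M \<longrightarrow> y \<mu> = 0) \<and> s = (\<Sum>\<mu>\<in>M. y \<mu>)
    \<and> (\<forall>\<mu>. shifted_deriv (diag_vf z c) (\<Sum>i<d. lam i * of_int (w i)) (y \<mu>) = mconst \<mu> * y \<mu>)
    \<and> (\<forall>i<d. shifted_deriv (diag_vf z (int_vec (a i))) (of_int (w i)) (y 0) = 0)"
  using assms(3)
proof (induction rule: eigen_span.induct)
  case (eigenvector f v)
  define \<nu> where "\<nu> = (\<Sum>i<d. lam i * of_int (v i + w i))"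
  define y where "y \<mu> = (if \<mu> = \<nu> then f else 0)" for \<mu>
  have "shifted_deriv (diag_vf z c) (\<Sum>i<d. lam i * of_int (w i)) f = mconst \<nu> * f"
    by (simp add: shifted_deriv_def diag_vf_decomposition[OF dec] eigenvector \<nu>_def mconst_sum
        mconst_hom sum_distrib_right distrib_left distrib_right sum.distrib mult.assoc)
  moreover have "shifted_deriv (diag_vf z (int_vec (a i))) (of_int (w i)) f = 0" if "i < d" "\<nu> = 0" for i
  proof -
    have "v i + w i = 0"
      using that spec[OF indep, of "\<lambda>i. v i + w i"] unfolding \<nu>_def by blast
    then have "(of_int (v i) :: complex) + of_int (w i) = 0"
      by (simp flip: of_int_add)
    then show ?thesis
      by (simp add: shifted_deriv_def eigenvector mconst_hom flip: distrib_right mconst_hom(3))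
  qed
  ultimately show ?case
    by (intro exI[of _ "{\<nu>}"] exI[of _ y]) (auto simp: y_def shifted_deriv_zero)
next
  case (add f g)
  obtain M y where y: "finite M" "\<And>\<mu>. \<mu> \<notin> M \<Longrightarrow> y \<mu> = 0" "f = (\<Sum>\<mu>\<in>M. y \<mu>)"
    "\<And>\<mu>. shifted_deriv (diag_vf z c) (\<Sum>i<d. lam i * of_int (w i)) (y \<mu>) = mconst \<mu> * y \<mu>"
    "\<And>i. i < d \<Longrightarrow> shifted_deriv (diag_vf z (int_vec (a i))) (of_int (w i)) (y 0) = 0"
    using add.IH(1) by blast
  obtain N x where x: "finite N" "\<And>\<mu>. \<mu> \<notin> N \<Longrightarrow> x \<mu> = 0" "g = (\<Sum>\<mu>\<in>N. x \<mu>)"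
    "\<And>\<mu>. shifted_deriv (diag_vf z c) (\<Sum>i<d. lam i * of_int (w i)) (x \<mu>) = mconst \<mu> * x \<mu>"
    "\<And>i. i < d \<Longrightarrow> shifted_deriv (diag_vf z (int_vec (a i))) (of_int (w i)) (x 0) = 0"
    using add.IH(2) by blast
  have "(\<Sum>\<mu>\<in>M. y \<mu>) = (\<Sum>\<mu>\<in>M \<union> N. y \<mu>)" "(\<Sum>\<mu>\<in>N. x \<mu>) = (\<Sum>\<mu>\<in>M \<union> N. x \<mu>)"
    using x(1,2) y(1,2) by (auto intro!: sum.mono_neutral_left)
  then have "f + g = (\<Sum>\<mu>\<in>M \<union> N. y \<mu> + x \<mu>)"
    by (simp add: x(3) y(3) sum.distrib)
  then show ?case
    using x(1,2,4,5) y(1,2,4,5)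
    by (intro exI[of _ "M \<union> N"] exI[of _ "\<lambda>\<mu>. y \<mu> + x \<mu>"]) (simp add: shifted_deriv_add distrib_left)
qed

text \<open>On an approximation of \<open>f\<close> by a sum of eigenvectors, the \<open>n\<close>-th power multiplies the
  part of eigenvalue \<open>\<mu>\<close> by \<open>\<mu>\<^sup>n\<close>. By separation, all parts with \<open>\<mu> \<noteq> 0\<close> are negligible, and the torus
  generators annihilate the part with \<open>\<mu> = 0\<close>.\<close>

lemma shifted_deriv_kernel_torus:
  assumes dec: "toric_decomposition c d lam a"
    and indep: "\<forall>b. (\<Sum>i<d. lam i * of_int (b i)) = 0 \<longrightarrow> (\<forall>i<d. b i = 0)"
    and f: "(shifted_deriv (diag_vf z c) (\<Sum>i<d. lam i * of_int (w i)) ^^ n) f \<in> vanishing k"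
    and e: "e < d"
  shows "shifted_deriv (diag_vf z (int_vec (a e))) (of_int (w e)) f \<in> vanishing k"
proof -
  let ?T = "shifted_deriv (diag_vf z c) (\<Sum>i<d. lam i * of_int (w i))"
  let ?A = "shifted_deriv (diag_vf z (int_vec (a e))) (of_int (w e))"
  obtain s where s: "s \<in> eigen_span a" "f - s \<in> vanishing k"
    using eigen_span_dense by blast
  obtain M y where y: "finite M" "s = (\<Sum>\<mu>\<in>M. y \<mu>)" "\<And>\<mu>. ?T (y \<mu>) = mconst \<mu> * y \<mu>" "?A (y 0) = 0"
    using eigen_span_decompose[OF dec indep s(1), of w] e by blast
  have T_add: "(?T ^^ n) (g + h) = (?T ^^ n) g + (?T ^^ n) h" for g h n
    by (induction n) (auto simp: shifted_deriv_add)
  have "(?T ^^ n) (f - s) \<in> vanishing k"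
    using s(2) by (auto intro: funpow_preserves shifted_deriv_vanishing diag_vf_vanishes)
  then have "(?T ^^ n) s \<in> vanishing k"
    using T_add[of n "f - s" s] f vanishing_diff[of "(?T ^^ n) f" k "(?T ^^ n) (f - s)"] by simp
  moreover have "(?T ^^ n) s = (\<Sum>\<mu>\<in>M. mconst (\<mu> ^ n) * y \<mu>)"
    unfolding y(2)
    by (induction n) (auto simp: mconst_hom shifted_deriv_sum shifted_deriv_mconst y(3) mult.assoc
        mult.left_commute)
  ultimately have "mconst (\<mu> ^ n) * y \<mu> \<in> vanishing k" if "\<mu> \<in> M" for \<mu>
    using that y(1,3)
    by (intro eigenvector_separation[OF diag_vf_vanishes[of c] y(1),
          where w = "\<Sum>i<d. lam i * of_int (w i)" and y = "\<lambda>\<mu>. mconst (\<mu> ^ n) * y \<mu>" and \<mu> = \<mu>])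
      (auto simp: shifted_deriv_mconst mult.left_commute)
  then have "y \<mu> \<in> vanishing k" if "\<mu> \<in> M" "\<mu> \<noteq> 0" for \<mu>
    using that mconst_cancel[of "\<mu> ^ n" "y \<mu>"] by simp
  then have "?A (y \<mu>) \<in> vanishing k" if "\<mu> \<in> M" for \<mu>
    using that y(4) by (cases "\<mu> = 0") (auto intro: shifted_deriv_vanishing diag_vf_vanishes)
  then have "?A s \<in> vanishing k"
    unfolding y(2) shifted_deriv_sum by (rule vanishing_sum)
  moreover have "?A (f - s) \<in> vanishing k"
    using s(2) by (intro shifted_deriv_vanishing diag_vf_vanishes)
  ultimately show ?thesis
    using vanishing_add[of "?A (f - s)" k "?A s"] by (simp flip: shifted_deriv_add)
qed

section \<open>The semisimple part acts diagonally and commutes with the vector field\<close>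

text \<open>The eigenvalue of the Lie derivative along \<open>\<Sum>\<^sub>j u\<^sub>j z\<^sub>j \<partial>/\<partial>z\<^sub>j\<close> on the product of frame elements
  with indices \<open>K\<close>. The values of \<open>u\<close> are complex for the semisimple part and integers for the torus generators.\<close>

definition tensor_weight :: "nat \<Rightarrow> nat \<Rightarrow> ('m \<Rightarrow> 'b::ab_group_add) \<Rightarrow> (nat \<Rightarrow> 'm) \<Rightarrow> 'b" where
  "tensor_weight p n u K = (\<Sum>r<n. if r < p then - u (K r) else u (K r))"

lemma tensor_weight_update:
  assumes "r < n"
  shows "tensor_weight p n u (K(r := k))
    = tensor_weight p n u K + (if r < p then u (K r) - u k else u k - u (K r))"
proof -
  have "tensor_weight p n u (K(r := k)) - tensor_weight p n u K
      = (\<Sum>s<n. if s = r then if r < p then u (K r) - u k else u k - u (K r) else 0)"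
    unfolding tensor_weight_def sum_subtractf[symmetric] by (intro sum.cong) auto
  then show ?thesis using assms by (simp add: algebra_simps)
qed

lemma lie_array_diag_vf:
  "lie_array (diag_vf z c) (frame_action p (diag_vf z c)) n g K
    = shifted_deriv (diag_vf z c) (tensor_weight p n (($) c) K) (g K)"
proof -
  have "slot r (frame_action p (diag_vf z c) r) g K
      = mconst (if r < p then - c $ K r else c $ K r) * g K" for r
  proof -
    have "slot r (frame_action p (diag_vf z c) r) g K
        = (\<Sum>k\<in>UNIV. if k = K r then mconst (if r < p then - c $ K r else c $ K r) * g (K(r := k)) else 0)"
      unfolding slot_def
      by (rule sum.cong) (auto simp: frame_action_def diag_vf_coord vf_apply_mconst_mult frame_deriv_coord mconst_hom)
    then show ?thesis by simp
  qed
  then show ?thesis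
    by (simp add: lie_array_def shifted_deriv_def tensor_weight_def mconst_sum sum_distrib_right)
qed

text \<open>The weights of the component and of the entry \<open>(i, k)\<close> of \<open>frame_action p X r\<close> add up to the weight of
  the component with index \<open>i\<close> replaced by \<open>k\<close>, because \<open>[X, S] = 0\<close> makes that entry an eigenfunction of \<open>S\<close>.\<close>

lemma lie_array_commute:
  fixes n p :: nat
  assumes "lie_bracket X (diag_vf z c) = 0"
  defines "LX \<equiv> lie_array X (frame_action p X) n"
    and "LS \<equiv> lie_array (diag_vf z c) (frame_action p (diag_vf z c)) n"
  shows "LS (LX g) = LX (LS g)"
proof
  fix K
  let ?S = "vf_apply (diag_vf z c)" and ?w = "tensor_weight p n (($) c)"
  have commute: "?S (vf_apply X f) = vf_apply X (?S f)" for f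
    using vf_apply_lie_bracket[of X "diag_vf z c" f] assms(1) by (simp add: vf_apply_def[of 0])
  have weight: "?S (frame_action p X r $ i $ k)
      = mconst (if r < p then c $ i - c $ k else c $ k - c $ i) * frame_action p X r $ i $ k" for r i k
    by (simp add: frame_action_def vf_apply_uminus diag_vf_frame_deriv commute diag_vf_coord
        vf_apply_mconst_mult mconst_hom left_diff_distrib)
  have "?S (frame_action p X r $ K r $ k * g (K(r := k))) + mconst (?w K) * (frame_action p X r $ K r $ k * g (K(r := k)))
      = frame_action p X r $ K r $ k * LS g (K(r := k))" if "r < n" for r k
    using that
    by (simp add: LS_def lie_array_diag_vf shifted_deriv_def tensor_weight_update vf_apply_mult weight
        mconst_hom algebra_simps)
  then have "?S (slot r (frame_action p X r) g K) + mconst (?w K) * slot r (frame_action p X r) g K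
      = slot r (frame_action p X r) (LS g) K" if "r < n" for r
    using that by (simp add: slot_def vf_apply_sum sum_distrib_left flip: sum.distrib)
  then have "(\<Sum>r<n. ?S (slot r (frame_action p X r) g K) + mconst (?w K) * slot r (frame_action p X r) g K)
      = (\<Sum>r<n. slot r (frame_action p X r) (LS g) K)"
    by simp
  moreover have "LS (LX g) K = ?S (vf_apply X (g K)) + mconst (?w K) * vf_apply X (g K)
      + (\<Sum>r<n. ?S (slot r (frame_action p X r) g K) + mconst (?w K) * slot r (frame_action p X r) g K)"
    by (simp add: LS_def lie_array_diag_vf shifted_deriv_def)
       (simp add: LX_def lie_array_def vf_apply_add vf_apply_sum distrib_left sum_distrib_left sum.distrib)
  moreover have "vf_apply X (LS g K) = ?S (vf_apply X (g K)) + mconst (?w K) * vf_apply X (g K)"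
    by (simp add: LS_def lie_array_diag_vf shifted_deriv_def vf_apply_add vf_apply_mconst_mult commute)
  ultimately show "LS (LX g) K = LX (LS g) K"
    by (simp add: LX_def lie_array_def)
qed

lemma lie_array_diff_vf:
  "lie_array (V - W) (frame_action p (V - W)) n g K
    = lie_array V (frame_action p V) n g K - lie_array W (frame_action p W) n g K"
proof -
  have "frame_action p (V - W) r = frame_action p V r - frame_action p W r" for r
    by (simp add: frame_action_def vf_apply_diff_left vf_apply_diff vec_eq_iff)
  then show ?thesis
    by (simp add: lie_array_def slot_def vf_apply_diff_left left_diff_distrib sum_subtractf)
qed

text \<open>At a zero of \<open>V\<close> the linear part is conjugated by the linear part of the coordinate change;
  second derivatives of \<open>z\<close> are multiplied by the vanishing components of \<open>V\<close>.\<close>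

lemma frame_linear_part_eq:
  assumes "vanishes_at_origin V"
  shows "frame_linear_part V = linear_part z ** linear_part V ** constant_part B"
proof -
  have J: "mcoeff (J $ i $ l) 0 = linear_part z $ i $ l" for i l
    using constant_part_J by (simp add: constant_part_def vec_eq_iff)
  have "mcoeff (pderiv_mfps j (vf_apply V (z $ i))) 0 = (linear_part z ** linear_part V) $ i $ j" for i j
    using assms
    by (simp add: vf_apply_coord pderiv_sum pderiv_mult mcoeff_sum mcoeff_mult_0 J vanishes_at_origin_def
        matrix_matrix_mult_def mcoeff_pderiv linear_part_def del: One_nat_def)
  then show ?thesis
    by (simp add: frame_linear_part_def vf_apply_def[of "coord_vf z _"] coord_vf_nth mcoeff_sum mcoeff_mult_0
        vec_eq_iff matrix_matrix_mult_def[of "linear_part z ** linear_part V"] constant_part_def mult.commute)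
qed

lemma frame_linear_part_nilpotent:
  assumes X: "vanishes_at_origin X" and S: "is_semisimple_part S (linear_part X)"
    and diag: "diagonalized_by (linear_part z) S c"
  shows "nilpotent_mat (frame_linear_part (diag_vf z c - X))"
proof -
  let ?P = "linear_part z" and ?C = "constant_part B"
  have inv: "?P ** ?C = mat 1" "?C ** ?P = mat 1"
    by (simp_all add: J_inverse constant_part_mat_1 flip: constant_part_J constant_part_mult)
  then have "matrix_inv ?P ** ?P = mat 1"
    unfolding matrix_inv_def by (metis (mono_tags, lifting) someI_ex)
  then have "matrix_inv ?P ** (?P ** ?C) = ?C"
    by (simp add: matrix_mul_assoc)
  then have "matrix_inv ?P = ?C"
    by (simp add: inv)
  then have D: "diag_mat c = ?P ** S ** ?C"
    using diag by (simp add: diagonalized_by_def)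
  have "frame_linear_part (diag_vf z c) = diag_mat c"
    by (auto simp: frame_linear_part_def diag_mat_def diag_vf_coord vf_apply_mconst_mult frame_deriv_coord
        vec_eq_iff mcoeff_one)
  then have "frame_linear_part (diag_vf z c - X) = ?P ** S ** ?C - ?P ** linear_part X ** ?C"
    unfolding D[symmetric] frame_linear_part_eq[OF X, symmetric]
    by (simp add: frame_linear_part_def vf_apply_diff_left vf_apply_diff vec_eq_iff)
  also have "\<dots> = ?P ** (- (linear_part X - S)) ** ?C"
    by (simp add: matrix_sub_ldistrib matrix_sub_rdistrib)
  also have "nilpotent_mat \<dots>"
    using S inv by (intro nilpotent_mat_conjugate nilpotent_mat_uminus) (auto simp: is_semisimple_part_def)
  finally show ?thesis .
qed

section \<open>Invariance under the associated torus\<close>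

text \<open>The semisimple operator agrees on \<open>g\<close> with a topologically nilpotent one. So each component of
  \<open>g\<close> is, modulo any order, in the generalized kernel of a shifted semisimple derivation, and
  \<open>shifted_deriv_kernel_torus\<close> applies.\<close>

lemma lie_array_torus_zero:
  assumes X: "vanishes_at_origin X" and bracket: "lie_bracket X (diag_vf z c) = 0"
    and N: "nilpotent_mat (frame_linear_part (diag_vf z c - X))"
    and dec: "toric_decomposition c d lam a"
    and indep: "\<forall>b. (\<Sum>i<d. lam i * of_int (b i)) = 0 \<longrightarrow> (\<forall>i<d. b i = 0)"
    and zero: "lie_array X (frame_action p X) n g = (\<lambda>K. 0)" and e: "e < d"
  shows "lie_array (diag_vf z (int_vec (a e))) (frame_action p (diag_vf z (int_vec (a e)))) n g = (\<lambda>K. 0)"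
proof (intro ext vanishing_all_imp_zero)
  fix K k
  let ?LX = "lie_array X (frame_action p X) n"
  let ?LS = "lie_array (diag_vf z c) (frame_action p (diag_vf z c)) n"
  let ?LY = "lie_array (diag_vf z c - X) (frame_action p (diag_vf z c - X)) n"
  have kernel: "?LX ((?LS ^^ j) g) = (\<lambda>K. 0)" for j
  proof (induction j)
    case (Suc j)
    have "?LX ((?LS ^^ Suc j) g) = ?LS (?LX ((?LS ^^ j) g))"
      by (simp add: lie_array_commute[OF bracket])
    also have "\<dots> = (\<lambda>K. 0)"
      unfolding Suc by (rule ext) (simp add: lie_array_diag_vf shifted_deriv_zero)
    finally show ?case .
  qed (simp add: zero)
  \<comment> \<open>On the orbit of \<open>g\<close> under \<open>?LS\<close> the operators \<open>?LY = ?LS - ?LX\<close> and \<open>?LS\<close> agree.\<close>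
  have powers: "(?LY ^^ j) g = (?LS ^^ j) g" for j
  proof (induction j)
    case (Suc j)
    have "?LY ((?LS ^^ j) g) = (\<lambda>K. ?LS ((?LS ^^ j) g) K - ?LX ((?LS ^^ j) g) K)"
      by (rule ext) (rule lie_array_diff_vf)
    then show ?case by (simp add: Suc kernel)
  qed simp
  have "vanishes_at_origin (diag_vf z c - X)"
    using X diag_vf_vanishes[of c] by (simp add: vanishes_at_origin_def)
  then obtain j where "(?LS ^^ j) g \<in> vanishing_arrays k"
    using lie_array_topologically_nilpotent[OF _ N, of p n k] powers by metis
  then have "(?LS ^^ j) g K \<in> vanishing k"
    unfolding vanishing_arrays_def by blast
  moreover have "(?LS ^^ j) g K = (shifted_deriv (diag_vf z c) (tensor_weight p n (($) c) K) ^^ j) (g K)"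
    by (induction j arbitrary: K) (simp_all add: lie_array_diag_vf)
  ultimately have "(shifted_deriv (diag_vf z c) (tensor_weight p n (($) c) K) ^^ j) (g K) \<in> vanishing k"
    by simp
  moreover have "tensor_weight p n (($) c) K = (\<Sum>i<d. lam i * of_int (tensor_weight p n (($) (a i)) K))"
  proof -
    have "tensor_weight p n (($) c) K
        = (\<Sum>r<n. \<Sum>i<d. lam i * of_int (if r < p then - a i $ K r else a i $ K r))"
      unfolding tensor_weight_def using dec
      by (intro sum.cong) (auto simp: toric_decomposition_def sum_negf)
    then show ?thesis
      by (subst (asm) sum.swap) (simp add: tensor_weight_def sum_distrib_left)
  qed
  ultimately have "shifted_deriv (diag_vf z (int_vec (a e))) (of_int (tensor_weight p n (($) (a e)) K)) (g K) \<in> vanishing k"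
    using e by (intro shifted_deriv_kernel_torus[OF dec indep, where n = j]) simp_all
  moreover have "tensor_weight p n (($) (int_vec (a e))) K = of_int (tensor_weight p n (($) (a e)) K)"
    by (auto simp: tensor_weight_def int_vec_def intro!: sum.cong)
  ultimately show "lie_array (diag_vf z (int_vec (a e))) (frame_action p (diag_vf z (int_vec (a e)))) n g K \<in> vanishing k"
    by (simp add: lie_array_diag_vf)
qed

end

theorem theorem6p1:
  fixes X :: "'m::finite formal_vf"
    and G :: "'m formal_tensor"
    and Z :: "nat \<Rightarrow> 'm formal_vf"
    and p q :: nat
  assumes "vanishes_at_origin X"
    and "G \<in> tensor_fields p q"
    and "lie_derivative X G = (\<lambda>I J. 0)"
    and "generates_associated_torus X Z"
  shows "torus_preserves (toric_degree X) Z G"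
proof -
  obtain z c lam a where normal: "normal_form_coords X z c"
    and dec: "toric_decomposition c (toric_degree X) lam a"
    and Z: "\<And>i. i < toric_degree X \<Longrightarrow> Z i = diag_vf z (int_vec (a i))"
    using assms(4) by (auto simp: generates_associated_torus_def int_vec_def)
  obtain S where S: "is_semisimple_part S (linear_part X)" "diagonalized_by (linear_part z) S c"
    using normal by (auto simp: normal_form_coords_def)
  interpret coordinate_frame z
    using normal by unfold_locales (simp add: normal_form_coords_def)
  \<comment> \<open>The toric degree minimizes over all diagonalizations, in particular over the one given by \<open>z\<close>.\<close>
  have "\<not> toric_decomposition c d' lam' a'" if "d' < toric_degree X" for d' lam' a'
    using not_less_Least[OF that[unfolded toric_degree_def]] S by blast
  then have indep: "\<forall>b. (\<Sum>i<toric_degree X. lam i * of_int (b i)) = 0 \<longrightarrow> (\<forall>i<toric_degree X. b i = 0)"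
    using minimal_decomposition_independent[OF dec] by blast
  have "lie_array X (frame_action p X) (p + q) (frame_components p q G) = (\<lambda>K. 0)"
    using lie_derivative_zero_iff_frame[OF assms(2)] assms(3) by blast
  then have "lie_derivative (Z i) G = (\<lambda>I J. 0)" if "i < toric_degree X" for i
    unfolding Z[OF that] lie_derivative_zero_iff_frame[OF assms(2)]
    using assms(1) normal frame_linear_part_nilpotent[OF assms(1) S] dec indep that
    by (intro lie_array_torus_zero) (auto simp: normal_form_coords_def)
  then show ?thesis by (simp add: torus_preserves_def)
qed

end
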